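(* Let $\mathcal{A}$ be a $C^*$-algebra and let $\{x_j\}_{j\in J}$ be a frame in $\mathcal{A}$ (regarded as a Hilbert module over itself). Then for any state $\psi$ on $\mathcal{A}$ there exists $j\in J$ such that $\psi(x_jx_j^* )\ne0$.
   Context: A state on $\mathcal{A}$ is a positive linear functional of norm $1$. $\dot{\mathcal{A}}$ denotes the unitalization of $\mathcal{A}$ (equal to $\mathcal{A}$ if $\mathcal{A}$ is unital). $\mathcal{A}$ is a right Hilbert module over itself and over $\dot{\mathcal{A}}$, with inner product $\langle a,b\rangle=a^*b$. When $\mathcal{A}$ is not unital, frames in $\mathcal{A}$ are understood with $\mathcal{A}$ regarded as a Hilbert $\dot{\mathcal{A}}$-module. Frame: let $\mathcal{N}$ be a Hilbert $C^*$-module over a unital $C^*$-algebra $\mathcal{B}$. A family $\{x_j\}_{j\in J}\subset\mathcal{N}$ is a standard frame if there are constants $c_1,c_2>0$ such that for every $x\in\mathcal{N}$ the series $\sum_j\langle x,x_j\rangle\langle x_j,x\rangle$ converges in norm and $c_1\langle x,x\rangle\le\sum_j\langle x,x_j\rangle\langle x_j,x\rangle\le c_2\langle x,x\rangle$. If the series (as the net of its finite partial sums) is only required to converge in the ultraweak ($\sigma$-weak) topology (of the universal enveloping von Neumann algebra of $\mathcal{B}$), the family is a non-standard frame. "Frame" means at least a non-standard frame. Equivalently (a known criterion), $\{x_j\}_{j\in J}$ is a frame iff there are $c_1,c_2>0$ with $c_1\varphi(\langle x,x\rangle)\le\sum_{j}\varphi(\langle x,x_j\rangle\langle x_j,x\rangle)\le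 c_2\varphi(\langle x,x\rangle)$ for all $x\in\mathcal{N}$ and all states $\varphi$ of $\mathcal{B}$. *)

theory Defs
  imports "HOL-Analysis.Analysis"
begin

section \<open>C*-algebras, not necessarily unital\<close>

class scaleC =
  fixes scaleC :: "complex \<Rightarrow> 'a \<Rightarrow> 'a"  (infixr "*\<^sub>C" 75)

class complex_banach = banach + scaleC +
  assumes scaleC_add_right: "c *\<^sub>C (x + y) = c *\<^sub>C x + c *\<^sub>C y"
    and scaleC_add_left: "(c + d) *\<^sub>C x = c *\<^sub>C x + d *\<^sub>C x"
    and scaleC_scaleC: "c *\<^sub>C d *\<^sub>C x = (c * d) *\<^sub>C x"
    and scaleC_of_real: "of_real r *\<^sub>C x = r *\<^sub>R x"
    and norm_scaleC: "norm (c *\<^sub>C x) = cmod c * norm x"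

class involution =
  fixes star :: "'a \<Rightarrow> 'a"

class cstar_algebra = complex_banach + real_normed_algebra + involution +
  assumes scaleC_mult_left: "(c *\<^sub>C x) * y = c *\<^sub>C (x * y)"
    and scaleC_mult_right: "x * (c *\<^sub>C y) = c *\<^sub>C (x * y)"
    and star_star: "star (star x) = x"
    and star_add: "star (x + y) = star x + star y"
    and star_scaleC: "star (c *\<^sub>C x) = cnj c *\<^sub>C star x"
    and star_mult: "star (x * y) = star y * star x"
    and norm_star_mult_self: "norm (star x * x) = (norm x)\<^sup>2"

definition unital :: "'a::cstar_algebra itself \<Rightarrow> bool" where
  "unital _ \<longleftrightarrow> (\<exists>e::'a. \<forall>a. e * a = a \<and> a * e = a)"

definition positive :: "'a::cstar_algebra \<Rightarrow> bool" where
  "positive a \<longleftrightarrow> (\<exists>b. a = star b * b)"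

definition cdual :: "('a::complex_banach \<Rightarrow> complex) set" where
  "cdual = {\<phi>. bounded_linear \<phi> \<and> (\<forall>c x. \<phi> (c *\<^sub>C x) = c * \<phi> x)}"

definition state :: "('a::cstar_algebra \<Rightarrow> complex) \<Rightarrow> bool" where
  "state \<phi> \<longleftrightarrow> \<phi> \<in> cdual \<and> (\<forall>a. positive a \<longrightarrow> \<phi> a \<in> \<real>\<^sub>\<ge>\<^sub>0) \<and> onorm \<phi> = 1"


section \<open>The universal enveloping von Neumann algebra\<close>

text \<open>The universal enveloping von Neumann algebra of a C*-algebra is taken to be its second
  dual with the Arens product and the induced involution; its ultraweak topology is then the
  weak-* topology given by the predual \<open>cdual\<close>. Elements of the second dual are represented by
  functions of which only the values on \<open>cdual\<close> matter, so equality is always tested there.\<close>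

type_synonym 'b bifunctional = "('b \<Rightarrow> complex) \<Rightarrow> complex"

definition second_dual :: "'b::complex_banach bifunctional set" where
  "second_dual = {F.
     (\<forall>\<phi>\<in>cdual. \<forall>\<xi>\<in>cdual. F (\<lambda>b. \<phi> b + \<xi> b) = F \<phi> + F \<xi>) \<and>
     (\<forall>c. \<forall>\<phi>\<in>cdual. F (\<lambda>b. c * \<phi> b) = c * F \<phi>) \<and>
     (\<exists>K. \<forall>\<phi>\<in>cdual. cmod (F \<phi>) \<le> K * onorm \<phi>)}"

definition to_second_dual :: "'b \<Rightarrow> 'b bifunctional" where
  "to_second_dual b = (\<lambda>\<phi>. \<phi> b)"

definition arens_mult ::
    "'b::cstar_algebra bifunctional \<Rightarrow> 'b bifunctional \<Rightarrow> 'b bifunctional" where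
  "arens_mult F G = (\<lambda>\<phi>. F (\<lambda>a. G (\<lambda>b. \<phi> (a * b))))"

definition second_dual_star :: "'b::cstar_algebra bifunctional \<Rightarrow> 'b bifunctional" where
  "second_dual_star F = (\<lambda>\<phi>. cnj (F (\<lambda>b. cnj (\<phi> (star b)))))"

definition second_dual_le :: "'b::cstar_algebra bifunctional \<Rightarrow> 'b bifunctional \<Rightarrow> bool" where
  "second_dual_le F G \<longleftrightarrow>
     (\<exists>H\<in>second_dual. \<forall>\<phi>\<in>cdual. G \<phi> - F \<phi> = arens_mult (second_dual_star H) H \<phi>)"

definition ultraweak_tendsto ::
    "('i \<Rightarrow> 'b::cstar_algebra bifunctional) \<Rightarrow> 'b bifunctional \<Rightarrow> 'i filter \<Rightarrow> bool" where
  "ultraweak_tendsto T F net \<longleftrightarrow> (\<forall>\<phi>\<in>cdual. ((\<lambda>i. T i \<phi>) \<longlongrightarrow> F \<phi>) net)"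

lemma to_second_dual_in_second_dual: "to_second_dual b \<in> second_dual"
proof -
  have "cmod (\<phi> b) \<le> norm b * onorm \<phi>" if "\<phi> \<in> cdual" for \<phi>
    using onorm[of \<phi> b] that by (simp add: cdual_def mult.commute)
  then show ?thesis
    by (auto simp: second_dual_def to_second_dual_def)
qed

lemma arens_mult_to_second_dual:
  "arens_mult (to_second_dual a) (to_second_dual b) = to_second_dual (a * b)"
  by (simp add: arens_mult_def to_second_dual_def)

lemma second_dual_star_to_second_dual:
  "second_dual_star (to_second_dual a) = to_second_dual (star a)"
  by (simp add: second_dual_star_def to_second_dual_def)


section \<open>Hilbert C*-modules and frames\<close>

locale hilbert_cstar_module =
  fixes ip :: "'n::complex_banach \<Rightarrow> 'n \<Rightarrow> 'b::cstar_algebra"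
    and act :: "'n \<Rightarrow> 'b \<Rightarrow> 'n"
  assumes act_add_left: "act (x + y) b = act x b + act y b"
    and act_add_right: "act x (a + b) = act x a + act x b"
    and act_act: "act (act x a) b = act x (a * b)"
    and act_scaleC_left: "act (c *\<^sub>C x) b = c *\<^sub>C act x b"
    and act_scaleC_right: "act x (c *\<^sub>C b) = c *\<^sub>C act x b"
    and ip_add_right: "ip x (y + z) = ip x y + ip x z"
    and ip_scaleC_right: "ip x (c *\<^sub>C y) = c *\<^sub>C ip x y"
    and ip_act_right: "ip x (act y b) = ip x y * b"
    and star_ip: "star (ip x y) = ip y x"
    and ip_positive: "positive (ip x x)"
    and norm_ip: "(norm x)\<^sup>2 = norm (ip x x)"
begin

text \<open>The non-standard frames. Standard frames are among them, since norm convergence implies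
  ultraweak convergence and the order of the algebra is that of its second dual. The coefficient
  algebra is meant to be unital.\<close>

definition frame :: "'j set \<Rightarrow> ('j \<Rightarrow> 'n) \<Rightarrow> bool" where
  "frame J xs \<longleftrightarrow>
     (\<exists>c1 > 0. \<exists>c2 > 0. \<forall>x. \<exists>F\<in>second_dual.
        ultraweak_tendsto (\<lambda>S. to_second_dual (\<Sum>j\<in>S. ip x (xs j) * ip (xs j) x)) F
          (finite_subsets_at_top J) \<and>
        second_dual_le (to_second_dual (c1 *\<^sub>R ip x x)) F \<and>
        second_dual_le F (to_second_dual (c2 *\<^sub>R ip x x)))"

end


section \<open>The unitalization of a non-unital C*-algebra\<close>

datatype 'a unitization = Unitization (alg_part: 'a) (scalar_part: complex)

definition left_mult :: "'a::cstar_algebra unitization \<Rightarrow> 'a \<Rightarrow> 'a" where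
  "left_mult u b = alg_part u * b + scalar_part u *\<^sub>C b"

lemma scaleR_commute: "c *\<^sub>C r *\<^sub>R x = r *\<^sub>R c *\<^sub>C (x::'a::complex_banach)"
  by (simp add: scaleC_of_real[symmetric] scaleC_scaleC mult.commute)

lemma bounded_linear_scaleC: "bounded_linear (\<lambda>x::'a::complex_banach. c *\<^sub>C x)"
  by (rule bounded_linear_intro[of _ "cmod c"])
    (simp_all add: scaleC_add_right scaleR_commute norm_scaleC)

lemma scaleC_zero_right [simp]: "c *\<^sub>C (0::'a::complex_banach) = 0"
  using linear_0[OF bounded_linear.linear[OF bounded_linear_scaleC]] .

lemma scaleC_zero_left [simp]: "0 *\<^sub>C (x::'a::complex_banach) = 0"
  using scaleC_of_real[of 0 x] by simp

lemma scaleC_one [simp]: "1 *\<^sub>C (x::'a::complex_banach) = x"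
  using scaleC_of_real[of 1 x] by simp

lemma scaleC_minus_left: "(- c) *\<^sub>C (x::'a::complex_banach) = - (c *\<^sub>C x)"
  using scaleC_add_left[of "-c" c x] by (simp add: eq_neg_iff_add_eq_0)

lemma scaleC_diff_left: "(c - d) *\<^sub>C (x::'a::complex_banach) = c *\<^sub>C x - d *\<^sub>C x"
  using scaleC_add_left[of c "-d" x] by (simp add: scaleC_minus_left)

lemma scaleC_sc: "(r *\<^sub>R c) *\<^sub>C (x::'a::complex_banach) = r *\<^sub>R c *\<^sub>C x"
  by (simp add: scaleC_of_real[symmetric] scaleC_scaleC scaleR_conv_of_real)

lemma onorm_scaleC:
  fixes f :: "'a::real_normed_vector \<Rightarrow> 'b::complex_banach"
  assumes f: "bounded_linear f"
  shows "onorm (\<lambda>x. c *\<^sub>C f x) = cmod c * onorm f"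
proof -
  have bl: "bounded_linear (\<lambda>x. d *\<^sub>C g x)" if "bounded_linear g" for d and g :: "'a \<Rightarrow> 'b"
    using bounded_linear_compose[OF bounded_linear_scaleC that] .
  have le: "onorm (\<lambda>x. d *\<^sub>C g x) \<le> cmod d * onorm g" if g: "bounded_linear g"
    for d and g :: "'a \<Rightarrow> 'b"
  proof (rule onorm_bound)
    show "0 \<le> cmod d * onorm g" using onorm_pos_le[OF g] by simp
    show "norm (d *\<^sub>C g x) \<le> cmod d * onorm g * norm x" for x
      using mult_left_mono[OF onorm[OF g, of x], of "cmod d"]
      by (simp add: norm_scaleC mult.assoc)
  qed
  show ?thesis
  proof (cases "c = 0")
    case True
    then show ?thesis by (simp add: onorm_zero)
  next
    case False
    have "onorm f \<le> cmod (inverse c) * onorm (\<lambda>x. c *\<^sub>C f x)"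
      using le[OF bl[OF f], of "inverse c" c] False by (simp add: scaleC_scaleC)
    then have "cmod c * onorm f \<le> onorm (\<lambda>x. c *\<^sub>C f x)"
      using False by (simp only: norm_inverse) (simp add: field_simps)
    with le[OF f, of c] show ?thesis by simp
  qed
qed

lemma star_zero [simp]: "star (0::'a::cstar_algebra) = 0"
  using star_add[of "0::'a" 0] by simp

lemma norm_star [simp]: "norm (star (a::'a::cstar_algebra)) = norm a"
proof -
  have le: "norm b \<le> norm (star b)" for b :: 'a
  proof (cases "b = 0")
    case False
    have "norm b * norm b \<le> norm (star b) * norm b"
      using norm_star_mult_self[of b] norm_mult_ineq[of "star b" b]
      by (simp add: power2_eq_square)
    with False show ?thesis by simp
  qed simp
  show ?thesis using le[of a] le[of "star a"] by (simp add: star_star)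
qed

lemma bounded_linear_left_mult: "bounded_linear (left_mult u)"
  unfolding left_mult_def
  by (intro bounded_linear_add bounded_linear_mult_right bounded_linear_scaleC)

text \<open>The norm is the operator norm of \<open>left_mult u\<close> whenever the algebra is not unital, because
  it then dominates the modulus of the scalar part (lemma \<open>scalar_part_le_onorm\<close>). The maximum only makes the type a C*-algebra
  for a unital algebra too, where it is not used below.\<close>

instantiation unitization :: (cstar_algebra) real_normed_vector
begin

definition "0 = Unitization 0 0"
definition "u + v = Unitization (alg_part u + alg_part v) (scalar_part u + scalar_part v)"
definition "u - v = Unitization (alg_part u - alg_part v) (scalar_part u - scalar_part v)"
definition "- u = Unitization (- alg_part u) (- scalar_part u)"
definition "r *\<^sub>R u = Unitization (r *\<^sub>R alg_part u) (r *\<^sub>R scalar_part u)"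
definition norm_unitization :: "'a unitization \<Rightarrow> real" where
  "norm_unitization u = max (onorm (left_mult u)) (cmod (scalar_part u))"
definition dist_unitization :: "'a unitization \<Rightarrow> 'a unitization \<Rightarrow> real" where
  "dist_unitization u v = norm (u - v)"
definition sgn_unitization :: "'a unitization \<Rightarrow> 'a unitization" where
  "sgn_unitization u = inverse (norm u) *\<^sub>R u"
definition uniformity_unitization :: "('a unitization \<times> 'a unitization) filter" where
  "uniformity_unitization = (INF e\<in>{0 <..}. principal {(u, v). dist u v < e})"
definition open_unitization :: "'a unitization set \<Rightarrow> bool" where
  "open_unitization U \<longleftrightarrow> (\<forall>u\<in>U. \<forall>\<^sub>F (u', v) in uniformity. u' = u \<longrightarrow> v \<in> U)"

instance
proof
  fix u v w :: "'a unitization" and r s :: real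
  show "u + v + w = u + (v + w)" "u + v = v + u" "0 + u = u" "- u + u = 0" "u - v = u + - v"
    by (simp_all add: plus_unitization_def minus_unitization_def uminus_unitization_def
        zero_unitization_def)
  show "r *\<^sub>R (u + v) = r *\<^sub>R u + r *\<^sub>R v" "(r + s) *\<^sub>R u = r *\<^sub>R u + s *\<^sub>R u"
    "r *\<^sub>R s *\<^sub>R u = (r * s) *\<^sub>R u" "1 *\<^sub>R u = u"
    by (simp_all add: plus_unitization_def scaleR_unitization_def algebra_simps)
  show "dist u v = norm (u - v)" "sgn u = inverse (norm u) *\<^sub>R u"
    "uniformity = (INF e\<in>{0 <..}. principal {(u::'a unitization, v). dist u v < e})"
    by (simp_all only: dist_unitization_def sgn_unitization_def uniformity_unitization_def)
  show "open U \<longleftrightarrow> (\<forall>u\<in>U. \<forall>\<^sub>F (u', v) in uniformity. u' = u \<longrightarrow> v \<in> U)"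
    for U :: "'a unitization set"
    by (rule open_unitization_def)
  show "norm u = 0 \<longleftrightarrow> u = 0"
  proof
    assume "norm u = 0"
    then have "scalar_part u = 0" and o: "onorm (left_mult u) \<le> 0"
      unfolding norm_unitization_def
      using onorm_pos_le[OF bounded_linear_left_mult, of u] by (auto simp: max_def split: if_splits)
    moreover have "left_mult u (star (alg_part u)) = 0"
      using onorm[OF bounded_linear_left_mult, of u "star (alg_part u)"] o
      by (metis mult_nonpos_nonneg norm_ge_zero norm_le_zero_iff order_trans)
    ultimately have "alg_part u * star (alg_part u) = 0"
      by (simp add: left_mult_def)
    then have "alg_part u = 0"
      using norm_star_mult_self[of "star (alg_part u)"] by (simp add: star_star)
    with \<open>scalar_part u = 0\<close> show "u = 0"
      by (cases u) (simp add: zero_unitization_def)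
  next
    assume "u = 0"
    moreover have "left_mult (0::'a unitization) = (\<lambda>x. 0)"
      by (rule ext) (simp add: left_mult_def zero_unitization_def)
    ultimately show "norm u = 0"
      by (simp add: norm_unitization_def onorm_zero) (simp add: zero_unitization_def)
  qed
  have "left_mult (u + v) = (\<lambda>x. left_mult u x + left_mult v x)"
    by (rule ext) (simp add: left_mult_def plus_unitization_def scaleC_add_left algebra_simps)
  then have "onorm (left_mult (u + v)) \<le> onorm (left_mult u) + onorm (left_mult v)"
    by (simp add: onorm_triangle bounded_linear_left_mult)
  moreover have "cmod (scalar_part (u + v)) \<le> cmod (scalar_part u) + cmod (scalar_part v)"
    by (simp add: plus_unitization_def norm_triangle_ineq)
  ultimately show "norm (u + v) \<le> norm u + norm v"
    unfolding norm_unitization_def by linarith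
  have "left_mult (r *\<^sub>R u) = (\<lambda>x. r *\<^sub>R left_mult u x)"
    by (rule ext) (simp add: left_mult_def scaleR_unitization_def scaleC_sc scaleR_add_right)
  then have "onorm (left_mult (r *\<^sub>R u)) = \<bar>r\<bar> * onorm (left_mult u)"
    by (simp add: onorm_scaleR bounded_linear_left_mult)
  moreover have "cmod (scalar_part (r *\<^sub>R u)) = \<bar>r\<bar> * cmod (scalar_part u)"
    by (simp add: scaleR_unitization_def)
  ultimately show "norm (r *\<^sub>R u) = \<bar>r\<bar> * norm u"
    unfolding norm_unitization_def by (simp add: max_mult_distrib_left)
qed

end

lemma scalar_part_le_norm: "cmod (scalar_part u) \<le> norm u"
  and onorm_left_mult_le_norm: "onorm (left_mult u) \<le> norm u"
  by (simp_all add: norm_unitization_def)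

lemma norm_Unitization_zero [simp]: "norm (Unitization a 0) = norm (a::'a::cstar_algebra)"
proof -
  have eq: "left_mult (Unitization a 0) = (\<lambda>b. a * b)"
    by (rule ext) (simp add: left_mult_def)
  have "onorm (\<lambda>b. a * b) \<le> norm a"
    by (rule onorm_bound) (simp_all add: norm_mult_ineq)
  moreover have "norm a \<le> onorm (\<lambda>b. a * b)"
  proof (cases "a = 0")
    case False
    have "norm a * norm a \<le> onorm (\<lambda>b. a * b) * norm a"
      using onorm[OF bounded_linear_mult_right[of a], of "star a"] norm_star_mult_self[of "star a"]
      by (simp add: star_star power2_eq_square)
    with False show ?thesis by simp
  qed (simp add: onorm_zero)
  ultimately have "onorm (\<lambda>b. a * b) = norm a" by (rule antisym)
  then show ?thesis
    by (simp add: norm_unitization_def eq)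
qed

lemma norm_unitization_le: "norm u \<le> norm (alg_part u) + cmod (scalar_part u)"
proof -
  have "norm (left_mult u b) \<le> (norm (alg_part u) + cmod (scalar_part u)) * norm b" for b
    unfolding left_mult_def
    by (rule order_trans[OF norm_triangle_ineq])
      (simp add: norm_scaleC norm_mult_ineq distrib_right)
  then have "onorm (left_mult u) \<le> norm (alg_part u) + cmod (scalar_part u)"
    by (intro onorm_bound) simp_all
  then show ?thesis by (simp add: norm_unitization_def)
qed

lemma norm_alg_part_le: "norm (alg_part u) \<le> 2 * norm u"
proof -
  have "Unitization (alg_part u) 0 = u - Unitization 0 (scalar_part u)"
    by (simp add: minus_unitization_def)
  then have "norm (alg_part u) = norm (u - Unitization 0 (scalar_part u))"
    by (metis norm_Unitization_zero)
  also have "\<dots> \<le> norm u + norm (Unitization (0::'a) (scalar_part u))"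
    by (rule norm_triangle_ineq4)
  also have "\<dots> \<le> norm u + cmod (scalar_part u)"
    using norm_unitization_le[of "Unitization (0::'a) (scalar_part u)"] by simp
  finally show ?thesis using scalar_part_le_norm[of u] by simp
qed

instantiation unitization :: (cstar_algebra) complex_banach
begin

definition "c *\<^sub>C u = Unitization (c *\<^sub>C alg_part u) (c * scalar_part u)"

instance
proof
  fix u v :: "'a unitization" and c d :: complex and r :: real
  show "c *\<^sub>C (u + v) = c *\<^sub>C u + c *\<^sub>C v" "(c + d) *\<^sub>C u = c *\<^sub>C u + d *\<^sub>C u"
    "c *\<^sub>C d *\<^sub>C u = (c * d) *\<^sub>C u"
    by (simp_all add: scaleC_unitization_def plus_unitization_def
        scaleC_add_right scaleC_add_left scaleC_scaleC distrib_left distrib_right mult.assoc)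
  show "of_real r *\<^sub>C u = r *\<^sub>R u"
    by (simp only: scaleC_unitization_def scaleR_unitization_def scaleC_of_real
        scaleR_conv_of_real[of r "scalar_part u"])
  have "left_mult (c *\<^sub>C u) = (\<lambda>x. c *\<^sub>C left_mult u x)"
    by (rule ext) (simp add: left_mult_def scaleC_unitization_def scaleC_mult_left
        scaleC_add_right scaleC_scaleC)
  then have "onorm (left_mult (c *\<^sub>C u)) = cmod c * onorm (left_mult u)"
    by (simp add: onorm_scaleC bounded_linear_left_mult)
  moreover have "cmod (scalar_part (c *\<^sub>C u)) = cmod c * cmod (scalar_part u)"
    by (simp add: scaleC_unitization_def norm_mult)
  ultimately show "norm (c *\<^sub>C u) = cmod c * norm u"
    unfolding norm_unitization_def by (simp add: max_mult_distrib_left)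
next
  fix U :: "nat \<Rightarrow> 'a unitization"
  assume U: "Cauchy U"
  have bound: "norm (alg_part (U m) - alg_part (U n)) \<le> 2 * norm (U m - U n)"
    "cmod (scalar_part (U m) - scalar_part (U n)) \<le> norm (U m - U n)" for m n
    using norm_alg_part_le[of "U m - U n"] scalar_part_le_norm[of "U m - U n"]
    by (simp_all add: minus_unitization_def)
  have "Cauchy (\<lambda>n. alg_part (U n))"
  proof (rule CauchyI)
    fix e :: real assume "0 < e"
    then obtain M where M: "\<And>m n. m \<ge> M \<Longrightarrow> n \<ge> M \<Longrightarrow> norm (U m - U n) < e / 2"
      using CauchyD[OF U, of "e / 2"] half_gt_zero by blast
    have "norm (alg_part (U m) - alg_part (U n)) < e" if "m \<ge> M" "n \<ge> M" for m n
      using M[OF that] bound(1)[of m n] by linarith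
    then show "\<exists>M. \<forall>m\<ge>M. \<forall>n\<ge>M. norm (alg_part (U m) - alg_part (U n)) < e" by blast
  qed
  then have "(\<lambda>n. alg_part (U n)) \<longlonglongrightarrow> lim (\<lambda>n. alg_part (U n))"
    by (simp only: Cauchy_convergent_iff convergent_LIMSEQ_iff)
  then obtain a where a: "(\<lambda>n. alg_part (U n)) \<longlonglongrightarrow> a" ..
  have "Cauchy (\<lambda>n. scalar_part (U n))"
  proof (rule CauchyI)
    fix e :: real assume "0 < e"
    then obtain M where M: "\<And>m n. m \<ge> M \<Longrightarrow> n \<ge> M \<Longrightarrow> norm (U m - U n) < e"
      using CauchyD[OF U, of e] by blast
    have "norm (scalar_part (U m) - scalar_part (U n)) < e" if "m \<ge> M" "n \<ge> M" for m n
      using M[OF that] bound(2)[of m n] by linarith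
    then show "\<exists>M. \<forall>m\<ge>M. \<forall>n\<ge>M. norm (scalar_part (U m) - scalar_part (U n)) < e" by blast
  qed
  then have "(\<lambda>n. scalar_part (U n)) \<longlonglongrightarrow> lim (\<lambda>n. scalar_part (U n))"
    by (simp only: Cauchy_convergent_iff convergent_LIMSEQ_iff)
  then obtain c where c: "(\<lambda>n. scalar_part (U n)) \<longlonglongrightarrow> c" ..
  have lim: "(\<lambda>n. norm (alg_part (U n) - a) + norm (scalar_part (U n) - c)) \<longlonglongrightarrow> 0"
    by (intro tendsto_add_zero tendsto_norm_zero LIM_zero a c)
  have le: "norm (U n - Unitization a c)
      \<le> norm (alg_part (U n) - a) + norm (scalar_part (U n) - c)" for n
    using norm_unitization_le[of "U n - Unitization a c"] by (simp add: minus_unitization_def)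
  have "(\<lambda>n. U n - Unitization a c) \<longlonglongrightarrow> 0"
    by (rule Lim_null_comparison[OF always_eventually[OF allI[OF le]] lim])
  then have "U \<longlonglongrightarrow> Unitization a c"
    by (rule LIM_zero_cancel)
  then show "convergent U"
    by (auto simp: convergent_def)
qed

end

instantiation unitization :: (cstar_algebra) cstar_algebra
begin

definition "u * v = Unitization
   (alg_part u * alg_part v + scalar_part u *\<^sub>C alg_part v + scalar_part v *\<^sub>C alg_part u)
   (scalar_part u * scalar_part v)"
definition "star u = Unitization (star (alg_part u)) (cnj (scalar_part u))"

instance
proof
  fix u v w :: "'a unitization" and c d :: complex and r :: real
  note defs = times_unitization_def star_unitization_def plus_unitization_def
    scaleR_unitization_def scaleC_unitization_def
  note rules = scaleC_add_right scaleC_add_left scaleC_scaleC scaleC_mult_left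
    scaleC_mult_right star_add star_mult star_scaleC star_star scaleR_commute scaleC_sc
  show "u * v * w = u * (v * w)" "(u + v) * w = u * w + v * w" "u * (v + w) = u * v + u * w"
    "r *\<^sub>R u * v = r *\<^sub>R (u * v)" "u * r *\<^sub>R v = r *\<^sub>R (u * v)"
    "c *\<^sub>C u * v = c *\<^sub>C (u * v)" "u * c *\<^sub>C v = c *\<^sub>C (u * v)"
    "star (star u) = u" "star (u + v) = star u + star v" "star (c *\<^sub>C u) = cnj c *\<^sub>C star u"
    "star (u * v) = star v * star u"
    by (simp_all add: defs rules algebra_simps)
  have op_mult: "left_mult (x * y) = left_mult x \<circ> left_mult y" for x y :: "'a unitization"
    by (rule ext) (simp add: left_mult_def defs rules algebra_simps)
  have le: "onorm (left_mult (x * y)) \<le> onorm (left_mult x) * onorm (left_mult y)"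
    for x y :: "'a unitization"
    unfolding op_mult by (intro onorm_compose bounded_linear_left_mult)
  show "norm (u * v) \<le> norm u * norm v"
  proof -
    have "onorm (left_mult (u * v)) \<le> norm u * norm v"
      by (rule order_trans[OF le])
        (intro mult_mono onorm_left_mult_le_norm onorm_pos_le bounded_linear_left_mult norm_ge_zero)
    moreover have "cmod (scalar_part (u * v)) \<le> norm u * norm v"
      by (simp add: times_unitization_def norm_mult mult_mono scalar_part_le_norm)
    ultimately show ?thesis by (simp add: norm_unitization_def[of "u * v"])
  qed
  have adj: "star (left_mult x b) * b' = star b * left_mult (star x) b'"
    for x :: "'a unitization" and b b'
    by (simp add: left_mult_def defs rules algebra_simps)
  have sq: "(onorm (left_mult x))\<^sup>2 \<le> onorm (left_mult (star x * x))" for x :: "'a unitization"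
  proof -
    let ?K = "onorm (left_mult (star x * x))"
    have K: "0 \<le> ?K" by (intro onorm_pos_le bounded_linear_left_mult)
    have "norm (left_mult x b) \<le> sqrt ?K * norm b" for b
    proof -
      have "(norm (left_mult x b))\<^sup>2 = norm (star b * left_mult (star x * x) b)"
        by (simp add: norm_star_mult_self[symmetric] adj op_mult)
      also have "\<dots> \<le> norm b * norm (left_mult (star x * x) b)"
        using norm_mult_ineq[of "star b"] by simp
      also have "\<dots> \<le> norm b * (?K * norm b)"
        by (intro mult_left_mono onorm bounded_linear_left_mult) simp
      also have "\<dots> = (sqrt ?K * norm b)\<^sup>2"
        using K by (simp add: power_mult_distrib) (simp add: power2_eq_square)
      finally show ?thesis
        by (rule power2_le_imp_le) (use K in simp)
    qed
    then have "onorm (left_mult x) \<le> sqrt ?K"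
      using K by (intro onorm_bound) simp_all
    then show ?thesis
      using K onorm_pos_le[OF bounded_linear_left_mult, of x]
      by (metis power_mono real_sqrt_pow2)
  qed
  have star_le: "onorm (left_mult x) \<le> onorm (left_mult (star x))" for x :: "'a unitization"
  proof (cases "onorm (left_mult x) = 0")
    case True
    then show ?thesis by (simp add: onorm_pos_le bounded_linear_left_mult)
  next
    case False
    then have "0 < onorm (left_mult x)"
      using onorm_pos_le[OF bounded_linear_left_mult, of x] by linarith
    moreover have "onorm (left_mult x) * onorm (left_mult x)
        \<le> onorm (left_mult (star x)) * onorm (left_mult x)"
      using sq[of x] le[of "star x" x] by (simp add: power2_eq_square)
    ultimately show ?thesis by simp
  qed
  have "onorm (left_mult (star u)) = onorm (left_mult u)"
    using star_le[of u] star_le[of "star u"] \<open>star (star u) = u\<close> by simp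
  then have "onorm (left_mult (star u * u)) = (onorm (left_mult u))\<^sup>2"
    using sq[of u] le[of "star u" u] by (simp add: power2_eq_square)
  moreover have "cmod (scalar_part (star u * u)) = (cmod (scalar_part u))\<^sup>2"
    by (simp add: defs norm_mult power2_eq_square)
  moreover have "max (s\<^sup>2) (t\<^sup>2) = (max s t)\<^sup>2" if "0 \<le> s" "0 \<le> t" for s t :: real
    using that by (auto simp: max_def power2_le_iff_abs_le dest: power2_le_imp_le power_mono)
  ultimately show "norm (star u * u) = (norm u)\<^sup>2"
    by (simp add: norm_unitization_def onorm_pos_le bounded_linear_left_mult)
qed

end

lemma unital_unitization: "unital TYPE('a::cstar_algebra unitization)"
  unfolding unital_def
  by (rule exI[of _ "Unitization 0 1"]) (simp add: times_unitization_def)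

lemma scalar_part_le_onorm:
  fixes u :: "'a::cstar_algebra unitization"
  assumes "\<not> unital TYPE('a)"
  shows "cmod (scalar_part u) \<le> onorm (left_mult u)"
proof (rule ccontr)
  assume "\<not> ?thesis"
  then have less: "onorm (left_mult u) < cmod (scalar_part u)" by simp
  define q where "q = onorm (left_mult u) / cmod (scalar_part u)"
  have pos: "0 < cmod (scalar_part u)"
    using less onorm_pos_le[OF bounded_linear_left_mult, of u] by linarith
  then have q: "0 \<le> q" "q < 1"
    using less onorm_pos_le[OF bounded_linear_left_mult, of u] by (simp_all add: q_def)
  define p where "p = (- inverse (scalar_part u)) *\<^sub>C alg_part u"
  have eq: "b - p * b = inverse (scalar_part u) *\<^sub>C left_mult u b" for b
    using pos by (simp add: p_def left_mult_def scaleC_mult_left scaleC_add_right scaleC_scaleC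
        scaleC_minus_left)
  have contr: "norm (b - p * b) \<le> q * norm b" for b
    using onorm[OF bounded_linear_left_mult, of u b] pos
    by (simp add: eq norm_scaleC norm_divide q_def field_simps)
  have inj: "b = 0" if "p * b = 0" for b
  proof (rule ccontr)
    assume "b \<noteq> 0"
    then have "q * norm b < 1 * norm b"
      using q by (intro mult_strict_right_mono) simp_all
    then show False using contr[of b] that by simp
  qed
  have "\<exists>!e. e - p * e + p = e"
  proof (rule banach_fix_type[OF q], intro allI)
    show "dist (x - p * x + p) (y - p * y + p) \<le> q * dist x y" for x y
    proof -
      have "(x - p * x + p) - (y - p * y + p) = (x - y) - p * (x - y)"
        by (simp add: right_diff_distrib)
      then show ?thesis using contr[of "x - y"] by (simp only: dist_norm)
    qed
  qed
  then obtain e where "e - p * e + p = e" by blast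
  then have e: "p * e = p" by simp
  have left: "e * b = b" for b
  proof -
    have "p * (e * b - b) = 0"
      by (simp add: right_diff_distrib mult.assoc[symmetric] e)
    then have "e * b - b = 0" by (rule inj)
    then show ?thesis by simp
  qed
  have right: "b * star e = b" for b
    by (metis left star_mult star_star)
  have "star e = e"
    using left[of "star e"] right[of e] by (rule trans[OF sym])
  with left right assms show False
    unfolding unital_def by metis
qed


section \<open>Frames in a C*-algebra\<close>

definition ip_self :: "'a::cstar_algebra \<Rightarrow> 'a \<Rightarrow> 'a" where
  "ip_self a b = star a * b"

definition ip_unitization :: "'a::cstar_algebra \<Rightarrow> 'a \<Rightarrow> 'a unitization" where
  "ip_unitization a b = Unitization (star a * b) 0"

definition act_unitization :: "'a::cstar_algebra \<Rightarrow> 'a unitization \<Rightarrow> 'a" where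
  "act_unitization a u = a * alg_part u + scalar_part u *\<^sub>C a"

lemma hilbert_cstar_module_self:
  "hilbert_cstar_module ip_self ((*) :: 'a::cstar_algebra \<Rightarrow> 'a \<Rightarrow> 'a)"
  by unfold_locales
    (auto simp: ip_self_def positive_def algebra_simps scaleC_mult_left scaleC_mult_right
      star_mult star_star norm_star_mult_self)

lemma hilbert_cstar_module_unitization:
  "hilbert_cstar_module ip_unitization (act_unitization :: 'a::cstar_algebra \<Rightarrow> _)"
proof
  fix x y z :: 'a and a b :: "'a unitization" and c :: complex
  note defs = ip_unitization_def act_unitization_def times_unitization_def star_unitization_def
    plus_unitization_def scaleC_unitization_def
  note rules = scaleC_add_right scaleC_add_left scaleC_scaleC scaleC_mult_left
    scaleC_mult_right star_mult star_star
  show "act_unitization (x + y) b = act_unitization x b + act_unitization y b"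
    "act_unitization x (a + b) = act_unitization x a + act_unitization x b"
    "act_unitization (act_unitization x a) b = act_unitization x (a * b)"
    "act_unitization (c *\<^sub>C x) b = c *\<^sub>C act_unitization x b"
    "act_unitization x (c *\<^sub>C b) = c *\<^sub>C act_unitization x b"
    "ip_unitization x (y + z) = ip_unitization x y + ip_unitization x z"
    "ip_unitization x (c *\<^sub>C y) = c *\<^sub>C ip_unitization x y"
    "ip_unitization x (act_unitization y b) = ip_unitization x y * b"
    "star (ip_unitization x y) = ip_unitization y x"
    by (simp_all add: defs rules algebra_simps)
  show "positive (ip_unitization x x)"
    unfolding positive_def
    by (rule exI[of _ "Unitization x 0"]) (simp add: defs)
  show "(norm x)\<^sup>2 = norm (ip_unitization x x)"
    by (simp add: ip_unitization_def norm_star_mult_self)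
qed

definition frame_in_algebra :: "'j set \<Rightarrow> ('j \<Rightarrow> 'a::cstar_algebra) \<Rightarrow> bool" where
  "frame_in_algebra J x \<longleftrightarrow>
     (if unital TYPE('a) then hilbert_cstar_module.frame ip_self J x
      else hilbert_cstar_module.frame ip_unitization J x)"

end

theory Submission
  imports Defs
begin

text \<open>Suppose that \<open>\<psi> (x j * star (x j)) = 0\<close> for every \<open>j\<close>. In the GNS representation, with vector
  \<open>\<Omega>\<close> for \<open>\<psi>\<close>, this says that every \<open>star (x j)\<close> annihilates \<open>\<Omega>\<close>, and so does every finite partial
  sum \<open>S\<close> of the elements \<open>x j * star (x j)\<close>. For \<open>e\<close> in the algebra the upper
  frame bound, applied to the vector \<open>e \<Omega> - \<Omega>\<close>, then gives
  \<open>\<langle>e \<Omega>, S e \<Omega>\<rangle> = \<langle>e \<Omega> - \<Omega>, S (e \<Omega> - \<Omega>)\<rangle> \<le> c2 \<parallel>e \<Omega> - \<Omega>\<parallel>\<^sup>2\<close>, uniformly in \<open>S\<close>, while the lower frame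
  bound makes the supremum over \<open>S\<close> at least \<open>c1 \<parallel>e \<Omega>\<parallel>\<^sup>2\<close>. As \<open>e \<Omega>\<close> can be chosen close to \<open>\<Omega>\<close>, this
  forces \<open>\<Omega> = 0\<close>. For a unital algebra \<open>e\<close> may be the unit, but the argument is the same in
  both cases; it is \<open>functional_zero_of_frame_bounds\<close>.

  No Hilbert space is constructed. Everything is phrased with the semi-inner product
  \<open>\<psi> (star a * b)\<close> on the algebra itself, and the vectors that its completion would provide are
  replaced by approximations from \<open>approximate_Riesz\<close>: a functional that is bounded for the
  seminorm is, up to \<open>\<epsilon>\<close>, the product with an element of the algebra. Two other facts are
  used.

  \<^item> The frame inequalities hold in the second dual, where an element is positive if it has the form
    \<open>star H * H\<close> for the Arens product. A positive functional is nonnegative on such elements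
    (\<open>arens_square_nonneg\<close>), so it turns the inequalities into scalar ones
    (\<open>frame_positive_functional\<close>).
  \<^item> A positive functional on an algebra without unit satisfies
    \<open>\<bar>\<psi> a\<bar>\<^sup>2 \<le> M \<psi> (star a * a)\<close> for a constant \<open>M\<close> (\<open>positive_functional_bound\<close>). This
    makes \<open>\<psi>\<close> itself bounded for the seminorm, which yields \<open>e\<close>, and lets \<open>\<psi>\<close> extend to a
    positive functional on the unitization (\<open>positive_functional_unitization\<close>), where the frame
    inequalities are stated. It rests on \<open>local_approximate_unit\<close>, proved with averages of powers of a
    Cayley transform in place of the functional calculus.\<close>


section \<open>Semi-inner products\<close>

lemma discriminant_le:
  fixes p q z :: real
  assumes "\<And>t. 0 \<le> p * t\<^sup>2 + 2 * t * z + q" and "0 \<le> p"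
  shows "z\<^sup>2 \<le> p * q"
proof (cases "p = 0")
  case True
  have "z = 0"
  proof (rule ccontr)
    assume "z \<noteq> 0"
    then have "2 * (- (q + 1) / (2 * z)) * z = - (q + 1)" by simp
    with assms(1)[of "- (q + 1) / (2 * z)"] True show False by simp
  qed
  with True show ?thesis by simp
next
  case False
  with assms have p: "p > 0" by simp
  have "p * (- z / p)\<^sup>2 + 2 * (- z / p) * z + q = q - z\<^sup>2 / p"
    using p by (simp add: power2_eq_square field_simps)
  with assms(1)[of "- z / p"] have "z\<^sup>2 / p \<le> q" by simp
  with p show ?thesis by (simp add: pos_divide_le_eq mult.commute)
qed

lemma le_at_zeroI:
  fixes f :: "real \<Rightarrow> real"
  assumes "isCont f 0" and "\<And>\<epsilon>. \<epsilon> > 0 \<Longrightarrow> c \<le> f \<epsilon>"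
  shows "c \<le> f 0"
proof -
  have lim: "(f \<longlongrightarrow> f 0) (at_right 0)"
    using assms(1) by (simp add: isCont_def filterlim_at_split)
  have "eventually (\<lambda>\<epsilon>. c \<le> f \<epsilon>) (at_right 0)"
    using eventually_at_right_less[of "0::real"] by (rule eventually_mono) (rule assms(2))
  from tendsto_lowerbound[OF lim this] show ?thesis by simp
qed

lemma obtain_phase:
  fixes z :: complex
  obtains \<alpha> where "cmod \<alpha> = 1" "\<alpha> * z = of_real (cmod z)"
proof (cases "z = 0")
  case True
  with that[of 1] show ?thesis by simp
next
  case False
  have "cmod (cnj z / of_real (cmod z)) = 1"
    using False by (simp add: norm_divide)
  moreover have "cnj z / of_real (cmod z) * z = of_real (cmod z)"
    using False by (simp add: mult.commute[of "cnj z"] complex_norm_square[symmetric] power2_eq_square)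
  ultimately show ?thesis by (rule that)
qed

locale semi_inner_product =
  fixes f :: "'a::complex_banach \<Rightarrow> 'a \<Rightarrow> complex"
  assumes add_left: "f (x + y) z = f x z + f y z"
    and add_right: "f x (y + z) = f x y + f x z"
    and scale_left: "f (c *\<^sub>C x) y = cnj c * f x y"
    and scale_right: "f x (c *\<^sub>C y) = c * f x y"
    and nonneg: "f x x \<in> \<real>\<^sub>\<ge>\<^sub>0"
begin

abbreviation sq :: "'a \<Rightarrow> real" where "sq x \<equiv> Re (f x x)"

lemma sq_nonneg: "0 \<le> sq x"
  and self_real: "Im (f x x) = 0"
  using nonneg[of x] by (auto simp: complex_nonneg_Reals_iff)

lemma hermitian: "f y x = cnj (f x y)"
proof -
  have 1: "Im (f x y + f y x) = 0"
    using self_real[of "x + y"] self_real[of x] self_real[of y] by (simp add: add_left add_right)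
  have 2: "Re (f x y) - Re (f y x) = 0"
    using self_real[of "x + \<i> *\<^sub>C y"] self_real[of x] self_real[of y]
    by (simp add: add_left add_right scale_left scale_right)
  show ?thesis using 1 2 by (simp add: complex_eq_iff)
qed

text \<open>The scalar is split into a real parameter and a phase because both minimisations below vary
  the real parameter only, after the phase has made the cross term real.\<close>

lemma sq_add_scaled:
  "sq (x + (of_real t * \<alpha>) *\<^sub>C y) = sq x + 2 * t * Re (\<alpha> * f x y) + t\<^sup>2 * (cmod \<alpha>)\<^sup>2 * sq y"
  unfolding cmod_power2
  by (simp add: add_left add_right scale_left scale_right hermitian[of y x] self_real
      power2_eq_square algebra_simps)

lemma Cauchy_Schwarz: "(cmod (f x y))\<^sup>2 \<le> sq x * sq y"
proof -
  obtain \<alpha> where \<alpha>: "cmod \<alpha> = 1" "\<alpha> * f x y = of_real (cmod (f x y))"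
    using obtain_phase .
  have "0 \<le> sq y * t\<^sup>2 + 2 * t * cmod (f x y) + sq x" for t
    using sq_nonneg[of "x + (of_real t * \<alpha>) *\<^sub>C y"] unfolding sq_add_scaled \<alpha>
    by (simp add: algebra_simps)
  from discriminant_le[OF this sq_nonneg] show ?thesis by (simp add: mult.commute)
qed

text \<open>The usual proof of the Riesz theorem, stopped before completeness is needed: in a Hilbert space
  the vector representing \<open>l\<close> minimises \<open>sq x - 2 * Re (l x)\<close>, and a point at which this quantity is within
  \<open>\<epsilon>\<^sup>2\<close> of its infimum represents \<open>l\<close> up to \<open>\<epsilon>\<close> in the dual seminorm.\<close>

lemma approximate_Riesz:
  assumes add: "\<And>x y. l (x + y) = l x + l y"
    and scale: "\<And>c x. l (c *\<^sub>C x) = c * l x"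
    and bound: "\<And>x. (cmod (l x))\<^sup>2 \<le> M * sq x"
    and "\<epsilon> > 0"
  shows "\<exists>b. \<forall>y. (cmod (l y - f b y))\<^sup>2 \<le> \<epsilon>\<^sup>2 * sq y"
proof -
  define Q where "Q x = sq x - 2 * Re (l x)" for x
  have lower: "- \<bar>M\<bar> \<le> Q x" for x
  proof -
    have "(cmod (l x))\<^sup>2 \<le> \<bar>M\<bar> * sq x"
      using bound[of x] mult_right_mono[OF abs_ge_self[of M] sq_nonneg[of x]] by linarith
    also have "\<dots> \<le> ((\<bar>M\<bar> + sq x) / 2)\<^sup>2"
      using zero_le_power2[of "(\<bar>M\<bar> - sq x) / 2"] by (simp add: power2_eq_square field_simps)
    finally have "cmod (l x) \<le> (\<bar>M\<bar> + sq x) / 2"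
      by (rule power2_le_imp_le) (use sq_nonneg[of x] in simp)
    with complex_Re_le_cmod[of "l x"] show ?thesis by (simp add: Q_def)
  qed
  then have bdd: "bdd_below (range Q)" by (auto intro!: bdd_belowI)
  have "(INF x. Q x) < (INF x. Q x) + \<epsilon>\<^sup>2" using \<open>\<epsilon> > 0\<close> by simp
  then obtain b where "Q b < (INF x. Q x) + \<epsilon>\<^sup>2"
    using cINF_less_iff[OF UNIV_not_empty bdd] by blast
  then have b: "Q b \<le> Q x + \<epsilon>\<^sup>2" for x
    using cINF_lower[OF bdd UNIV_I, of x] by linarith
  have "(cmod (l y - f b y))\<^sup>2 \<le> \<epsilon>\<^sup>2 * sq y" for y
  proof -
    obtain \<alpha> where \<alpha>: "cmod \<alpha> = 1" "\<alpha> * (l y - f b y) = of_real (cmod (l y - f b y))"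
      using obtain_phase .
    \<comment> \<open>Moving from \<open>b\<close> in the direction \<open>y\<close> can lower \<open>Q\<close> by at most \<open>\<epsilon>\<^sup>2\<close>.\<close>
    have "0 \<le> sq y * t\<^sup>2 + 2 * t * (- cmod (l y - f b y)) + \<epsilon>\<^sup>2" for t
    proof -
      have "Q (b + (of_real t * \<alpha>) *\<^sub>C y) = Q b + 2 * t * (Re (\<alpha> * f b y) - Re (\<alpha> * l y)) + t\<^sup>2 * sq y"
        unfolding Q_def sq_add_scaled add scale \<alpha>(1) by (simp add: algebra_simps)
      moreover have "Re (\<alpha> * f b y) - Re (\<alpha> * l y) = - cmod (l y - f b y)"
        using arg_cong[OF \<alpha>(2), of Re] by (simp add: algebra_simps)
      ultimately show ?thesis
        using b[of "b + (of_real t * \<alpha>) *\<^sub>C y"] by (simp add: mult.commute[of "sq y"])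
    qed
    from discriminant_le[OF this sq_nonneg] show ?thesis by (simp add: mult.commute)
  qed
  then show ?thesis by blast
qed

end

section \<open>Positive functionals\<close>

definition positive_functional :: "('a::cstar_algebra \<Rightarrow> complex) \<Rightarrow> bool" where
  "positive_functional \<phi> \<longleftrightarrow> \<phi> \<in> cdual \<and> (\<forall>a. \<phi> (star a * a) \<in> \<real>\<^sub>\<ge>\<^sub>0)"

lemma cdualD:
  assumes "\<phi> \<in> cdual"
  shows "bounded_linear \<phi>" "\<phi> (x + y) = \<phi> x + \<phi> y" "\<phi> (x - y) = \<phi> x - \<phi> y"
    "\<phi> (c *\<^sub>C x) = c * \<phi> x" "\<phi> (r *\<^sub>R x) = of_real r * \<phi> x" "\<phi> 0 = 0"
    "\<phi> (sum g A) = (\<Sum>a\<in>A. \<phi> (g a))" "cmod (\<phi> x) \<le> onorm \<phi> * norm x"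
proof -
  show bl: "bounded_linear \<phi>" and "\<phi> (c *\<^sub>C x) = c * \<phi> x" using assms by (auto simp: cdual_def)
  show "\<phi> (x + y) = \<phi> x + \<phi> y" "\<phi> (x - y) = \<phi> x - \<phi> y" "\<phi> 0 = 0"
    "\<phi> (r *\<^sub>R x) = of_real r * \<phi> x" "\<phi> (sum g A) = (\<Sum>a\<in>A. \<phi> (g a))"
    using bl bounded_linear.linear[OF bl]
    by (simp_all add: linear_add linear_diff linear_0 linear_scale linear_sum scaleR_conv_of_real)
  show "cmod (\<phi> x) \<le> onorm \<phi> * norm x" by (rule onorm[OF bl])
qed

lemma semi_inner_product_functional:
  assumes "positive_functional \<phi>"
  shows "semi_inner_product (\<lambda>a b. \<phi> (star a * b))"
  using assms
  by unfold_locales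
    (auto simp: positive_functional_def cdualD star_add star_scaleC distrib_left distrib_right
      scaleC_mult_left scaleC_mult_right)

lemma functional_star_mult_le:
  fixes \<phi> :: "'a::cstar_algebra \<Rightarrow> complex"
  assumes "\<phi> \<in> cdual"
  shows "Re (\<phi> (star a * a)) \<le> onorm \<phi> * (norm a)\<^sup>2"
  using order_trans[OF complex_Re_le_cmod cdualD(8)[OF assms], of "star a * a"]
  by (simp only: norm_star_mult_self)

lemma positive_functional_Cauchy_Schwarz:
  assumes "positive_functional \<phi>"
  shows "(cmod (\<phi> (star a * b)))\<^sup>2 \<le> Re (\<phi> (star a * a)) * Re (\<phi> (star b * b))"
  using semi_inner_product.Cauchy_Schwarz[OF semi_inner_product_functional[OF assms]] .

lemma cdual_left_mult:
  fixes \<phi> :: "'a::cstar_algebra \<Rightarrow> complex"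
  assumes "\<phi> \<in> cdual"
  shows "(\<lambda>b. \<phi> (a * b)) \<in> cdual"
  using assms bounded_linear_compose[OF cdualD(1)[OF assms] bounded_linear_mult_right[of a]]
  by (simp add: cdual_def scaleC_mult_right)

lemma onorm_left_mult_functional:
  assumes "positive_functional \<phi>"
  shows "(onorm (\<lambda>b. \<phi> (star a * b)))\<^sup>2 \<le> onorm \<phi> * Re (\<phi> (star a * a))"
proof -
  have \<phi>: "\<phi> \<in> cdual" using assms by (simp add: positive_functional_def)
  let ?n = "onorm \<phi>" and ?p = "Re (\<phi> (star a * a))"
  have n: "0 \<le> ?n" using onorm_pos_le[OF cdualD(1)[OF \<phi>]] .
  have p: "0 \<le> ?p"
    using semi_inner_product.sq_nonneg[OF semi_inner_product_functional[OF assms]] .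
  have "onorm (\<lambda>b. \<phi> (star a * b)) \<le> sqrt (?n * ?p)"
  proof (rule onorm_bound)
    show "cmod (\<phi> (star a * b)) \<le> sqrt (?n * ?p) * norm b" for b
    proof (rule power2_le_imp_le)
      have "(cmod (\<phi> (star a * b)))\<^sup>2 \<le> ?p * Re (\<phi> (star b * b))"
        by (rule positive_functional_Cauchy_Schwarz[OF assms])
      also have "\<dots> \<le> ?p * (?n * (norm b)\<^sup>2)"
        by (rule mult_left_mono[OF functional_star_mult_le[OF \<phi>] p])
      also have "\<dots> = (sqrt (?n * ?p) * norm b)\<^sup>2"
        using n p by (simp add: power_mult_distrib mult_ac)
      finally show "(cmod (\<phi> (star a * b)))\<^sup>2 \<le> (sqrt (?n * ?p) * norm b)\<^sup>2" .
    qed (use n p in simp)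
  qed (use n p in simp)
  then have "(onorm (\<lambda>b. \<phi> (star a * b)))\<^sup>2 \<le> (sqrt (?n * ?p))\<^sup>2"
    by (rule power_mono) (rule onorm_pos_le[OF cdualD(1)[OF cdual_left_mult[OF \<phi>]]])
  with n p show ?thesis by simp
qed

section \<open>Positive functionals on the second dual\<close>

lemma second_dualD:
  assumes "F \<in> second_dual"
  shows second_dual_add: "\<lbrakk>\<phi> \<in> cdual; \<xi> \<in> cdual\<rbrakk> \<Longrightarrow> F (\<lambda>b. \<phi> b + \<xi> b) = F \<phi> + F \<xi>"
    and second_dual_scale: "\<phi> \<in> cdual \<Longrightarrow> F (\<lambda>b. c * \<phi> b) = c * F \<phi>"
  using assms by (auto simp: second_dual_def)

lemma second_dual_diff:
  assumes "F \<in> second_dual" "\<phi> \<in> cdual" "\<xi> \<in> cdual"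
  shows "F (\<lambda>b. \<phi> b - \<xi> b) = F \<phi> - F \<xi>"
proof -
  have "(\<lambda>b. (-1) * \<xi> b) \<in> cdual"
    using assms(3) by (auto simp: cdual_def intro: bounded_linear_minus)
  from second_dual_add[OF assms(1,2) this] second_dual_scale[OF assms(1,3), of "-1"]
  show ?thesis by simp
qed

lemma second_dual_bound:
  assumes "F \<in> second_dual"
  obtains K where "K \<ge> 0" "\<And>\<phi>. \<phi> \<in> cdual \<Longrightarrow> cmod (F \<phi>) \<le> K * onorm \<phi>"
proof -
  from assms obtain K where K: "\<And>\<phi>. \<phi> \<in> cdual \<Longrightarrow> cmod (F \<phi>) \<le> K * onorm \<phi>"
    unfolding second_dual_def by blast
  have "cmod (F \<phi>) \<le> \<bar>K\<bar> * onorm \<phi>" if "\<phi> \<in> cdual" for \<phi>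
    using K[OF that] mult_right_mono[OF abs_ge_self[of K] onorm_pos_le[OF cdualD(1)[OF that]]]
    by linarith
  with that[of "\<bar>K\<bar>"] show ?thesis by simp
qed

text \<open>In the GNS space of \<open>\<phi>\<close>, a bounded functional \<open>H\<close> on the dual sends \<open>\<phi> (star b * _)\<close> to \<open>\<langle>b, \<xi>\<rangle>\<close> for
  some vector \<open>\<xi>\<close>, and the value in question is \<open>\<parallel>\<xi>\<parallel>\<^sup>2\<close>. Here \<open>l b\<close> is \<open>\<langle>\<xi>, b\<rangle>\<close>, and \<open>\<xi>\<close> itself is
  replaced by an element \<open>b\<close> that represents \<open>l\<close> approximately; then \<open>H l\<close> is close to
  \<open>H (\<phi> (star b * _)) = cnj (l b)\<close>, which is close to \<open>\<phi> (star b * b)\<close>.\<close>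

lemma arens_square_nonneg:
  assumes \<phi>: "positive_functional \<phi>" and H: "H \<in> second_dual"
  shows "0 \<le> Re (arens_mult (second_dual_star H) H \<phi>)"
proof -
  interpret semi_inner_product "\<lambda>a b. \<phi> (star a * b)"
    by (rule semi_inner_product_functional[OF \<phi>])
  have \<phi>': "\<phi> \<in> cdual" using \<phi> by (simp add: positive_functional_def)
  note dual = cdual_left_mult[OF \<phi>']
  define N where "N = onorm \<phi>"
  have N: "0 \<le> N" using onorm_pos_le[OF cdualD(1)[OF \<phi>']] by (simp add: N_def)
  obtain K where K: "K \<ge> 0" "\<And>\<phi>. \<phi> \<in> cdual \<Longrightarrow> cmod (H \<phi>) \<le> K * onorm \<phi>"
    using second_dual_bound[OF H] by blast
  define l where "l b = cnj (H (\<lambda>c. \<phi> (star b * c)))" for b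
  have l_add: "l (x + y) = l x + l y" for x y
    using second_dual_add[OF H dual dual, of "star x" "star y"]
    by (simp add: l_def star_add distrib_right cdualD[OF \<phi>'])
  have l_scale: "l (c *\<^sub>C x) = c * l x" for c x
    using second_dual_scale[OF H dual, of "cnj c" "star x"]
    by (simp add: l_def star_scaleC scaleC_mult_left cdualD[OF \<phi>'])
  have l_bound: "(cmod (l x))\<^sup>2 \<le> (K\<^sup>2 * N) * sq x" for x
  proof -
    have "(cmod (l x))\<^sup>2 \<le> (K * onorm (\<lambda>c. \<phi> (star x * c)))\<^sup>2"
      unfolding l_def by (intro power_mono) (simp_all add: K(2)[OF dual])
    also have "\<dots> \<le> K\<^sup>2 * (N * sq x)"
      using mult_left_mono[OF onorm_left_mult_functional[OF \<phi>, of x], of "K\<^sup>2"]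
      by (simp add: power_mult_distrib N_def)
    finally show ?thesis by (simp add: mult.assoc)
  qed
  have sq_le: "sq x \<le> N * (norm x)\<^sup>2" for x
    using functional_star_mult_le[OF \<phi>'] by (simp add: N_def)
  have l_dual: "l \<in> cdual"
  proof -
    have "norm (l x) \<le> norm x * (K * N)" for x
    proof (rule power2_le_imp_le)
      have "(norm (l x))\<^sup>2 \<le> (K\<^sup>2 * N) * (N * (norm x)\<^sup>2)"
        by (rule order_trans[OF l_bound mult_left_mono[OF sq_le]]) (simp add: N)
      then show "(norm (l x))\<^sup>2 \<le> (norm x * (K * N))\<^sup>2"
        by (simp add: power_mult_distrib power2_eq_square mult_ac)
    qed (simp add: K N)
    then have "bounded_linear l"
      using l_scale[of "of_real _"]
      by (intro bounded_linear_intro[of l]) (auto simp: l_add scaleC_of_real scaleR_conv_of_real)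
    with l_scale show ?thesis by (simp add: cdual_def)
  qed
  have eq: "arens_mult (second_dual_star H) H \<phi> = cnj (H l)"
    by (simp add: arens_mult_def second_dual_star_def l_def[abs_def])
  have approx: "- Re (H l) \<le> \<epsilon>\<^sup>2 / 4 + K * (\<epsilon> * sqrt N)" if "\<epsilon> > 0" for \<epsilon>
  proof -
    obtain b where b: "\<And>y. (cmod (l y - \<phi> (star b * y)))\<^sup>2 \<le> \<epsilon>\<^sup>2 * sq y"
      using approximate_Riesz[of l, OF l_add l_scale l_bound \<open>\<epsilon> > 0\<close>] by blast
    have d: "cmod (l y - \<phi> (star b * y)) \<le> \<epsilon> * sqrt (sq y)" for y
      by (rule power2_le_imp_le) (use b[of y] sq_nonneg[of y] \<open>\<epsilon> > 0\<close> in \<open>simp_all add: power_mult_distrib\<close>)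
    have "cmod (H l - H (\<lambda>c. \<phi> (star b * c))) = cmod (H (\<lambda>c. l c - \<phi> (star b * c)))"
      by (simp add: second_dual_diff[OF H l_dual dual])
    also have "\<dots> \<le> K * onorm (\<lambda>c. l c - \<phi> (star b * c))"
      using l_dual dual[of "star b"]
      by (intro K(2)) (auto simp: cdual_def bounded_linear_sub algebra_simps)
    also have "\<dots> \<le> K * (\<epsilon> * sqrt N)"
    proof (intro mult_left_mono K onorm_bound)
      fix y
      have "\<epsilon> * sqrt (sq y) \<le> \<epsilon> * sqrt (N * (norm y)\<^sup>2)"
        using \<open>\<epsilon> > 0\<close> sq_le[of y] by simp
      with d[of y] show "cmod (l y - \<phi> (star b * y)) \<le> \<epsilon> * sqrt N * norm y"
        by (simp add: real_sqrt_mult)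
    qed (use N \<open>\<epsilon> > 0\<close> in simp)
    finally have 1: "cmod (H l - H (\<lambda>c. \<phi> (star b * c))) \<le> K * (\<epsilon> * sqrt N)" .
    have "Re (\<phi> (star b * b) - l b) \<le> \<epsilon> * sqrt (sq b)"
      by (rule order_trans[OF complex_Re_le_cmod]) (simp add: norm_minus_commute d)
    \<comment> \<open>Completing the square absorbs the error into \<open>sq b\<close>, so that no bound on \<open>sq b\<close> is called for.\<close>
    moreover have "\<epsilon> * sqrt (sq b) \<le> sq b + \<epsilon>\<^sup>2 / 4"
      using zero_le_power2[of "sqrt (sq b) - \<epsilon> / 2"] sq_nonneg[of b]
      by (simp add: power2_diff field_simps)
    moreover have "Re (H (\<lambda>c. \<phi> (star b * c))) = Re (l b)" by (simp add: l_def)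
    ultimately show ?thesis
      using 1 abs_Re_le_cmod[of "H l - H (\<lambda>c. \<phi> (star b * c))"] by simp
  qed
  have "- Re (H l) \<le> 0\<^sup>2 / 4 + K * (0 * sqrt N)"
    by (rule le_at_zeroI[of "\<lambda>\<epsilon>. \<epsilon>\<^sup>2 / 4 + K * (\<epsilon> * sqrt N)", OF _ approx]) simp_all
  then show ?thesis by (simp add: eq)
qed

lemma second_dual_le_positive_functional:
  assumes "second_dual_le F G" "positive_functional \<phi>"
  shows "Re (F \<phi>) \<le> Re (G \<phi>)"
proof -
  obtain H where H: "H \<in> second_dual"
    and *: "\<And>\<phi>. \<phi> \<in> cdual \<Longrightarrow> G \<phi> - F \<phi> = arens_mult (second_dual_star H) H \<phi>"
    using assms(1) by (auto simp: second_dual_le_def)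
  have "\<phi> \<in> cdual" using assms(2) by (simp add: positive_functional_def)
  from arg_cong[OF *[OF this], of Re] arens_square_nonneg[OF assms(2) H] show ?thesis by simp
qed

context hilbert_cstar_module
begin

text \<open>Ultraweak convergence is tested on functionals, and the order of the second dual is respected by
  the positive ones, so a positive functional sees an ordinary convergent series of reals between the
  two frame bounds.\<close>

lemma frame_positive_functional:
  assumes "frame J xs" and \<phi>: "positive_functional \<phi>"
  obtains c1 c2 L where "c1 > 0" "c2 > 0"
    "\<And>y. ((\<lambda>j. Re (\<phi> (ip y (xs j) * ip (xs j) y))) has_sum L y) J"
    "\<And>y. c1 * Re (\<phi> (ip y y)) \<le> L y" "\<And>y. L y \<le> c2 * Re (\<phi> (ip y y))"
proof -
  have \<phi>': "\<phi> \<in> cdual" using \<phi> by (simp add: positive_functional_def)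
  from assms(1) obtain c1 c2 where c: "c1 > 0" "c2 > 0"
    and *: "\<forall>y. \<exists>F\<in>second_dual.
        ultraweak_tendsto (\<lambda>S. to_second_dual (\<Sum>j\<in>S. ip y (xs j) * ip (xs j) y)) F
          (finite_subsets_at_top J) \<and>
        second_dual_le (to_second_dual (c1 *\<^sub>R ip y y)) F \<and>
        second_dual_le F (to_second_dual (c2 *\<^sub>R ip y y))"
    unfolding frame_def by blast
  have "\<forall>y. \<exists>L. ((\<lambda>j. Re (\<phi> (ip y (xs j) * ip (xs j) y))) has_sum L) J \<and>
      c1 * Re (\<phi> (ip y y)) \<le> L \<and> L \<le> c2 * Re (\<phi> (ip y y))"
  proof
    fix y
    from * obtain F where
      F: "ultraweak_tendsto (\<lambda>S. to_second_dual (\<Sum>j\<in>S. ip y (xs j) * ip (xs j) y)) F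
          (finite_subsets_at_top J)" and
      le: "second_dual_le (to_second_dual (c1 *\<^sub>R ip y y)) F"
        "second_dual_le F (to_second_dual (c2 *\<^sub>R ip y y))"
      by blast
    from F[unfolded ultraweak_tendsto_def, rule_format, OF \<phi>']
    have "((\<lambda>S. \<Sum>j\<in>S. \<phi> (ip y (xs j) * ip (xs j) y)) \<longlongrightarrow> F \<phi>) (finite_subsets_at_top J)"
      by (simp add: to_second_dual_def cdualD(7)[OF \<phi>'])
    from tendsto_Re[OF this]
    have "((\<lambda>j. Re (\<phi> (ip y (xs j) * ip (xs j) y))) has_sum Re (F \<phi>)) J"
      by (simp add: has_sum_def)
    moreover have "c1 * Re (\<phi> (ip y y)) \<le> Re (F \<phi>)" "Re (F \<phi>) \<le> c2 * Re (\<phi> (ip y y))"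
      using le[THEN second_dual_le_positive_functional, OF \<phi>]
      by (simp_all add: to_second_dual_def cdualD(5)[OF \<phi>'])
    ultimately show "\<exists>L. ((\<lambda>j. Re (\<phi> (ip y (xs j) * ip (xs j) y))) has_sum L) J \<and>
      c1 * Re (\<phi> (ip y y)) \<le> L \<and> L \<le> c2 * Re (\<phi> (ip y y))" by blast
  qed
  from choice[OF this] that c show thesis by blast
qed

end

section \<open>Local approximate units\<close>

lemma star_simps:
  fixes a b :: "'a::cstar_algebra"
  shows star_minus: "star (- a) = - star a"
    and star_diff: "star (a - b) = star a - star b"
    and star_scaleR: "star (r *\<^sub>R a) = r *\<^sub>R star a"
proof -
  show m: "star (- a) = - star a" for a :: 'a
    using star_add[of a "- a"] by (simp add: eq_neg_iff_add_eq_0 add.commute)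
  show "star (a - b) = star a - star b"
    using star_add[of a "- b"] by (simp add: m)
  show "star (r *\<^sub>R a) = r *\<^sub>R star a"
    by (simp add: scaleC_of_real[symmetric] star_scaleC)
qed

lemma scaleC_minus_right: "c *\<^sub>C (- x) = - (c *\<^sub>C (x::'a::complex_banach))"
  using scaleC_add_right[of c x "-x"] by (simp add: eq_neg_iff_add_eq_0 add.commute)

lemma scaleC_diff_right: "c *\<^sub>C (x - y) = c *\<^sub>C x - c *\<^sub>C (y::'a::complex_banach)"
  using scaleC_add_right[of c x "-y"] by (simp add: scaleC_minus_right)

lemma isometry_norm_mult:
  fixes u a :: "'a::cstar_algebra"
  assumes "star u * u * a = a"
  shows "norm (u * a) = norm a"
proof -
  have "(norm (u * a))\<^sup>2 = norm (star (u * a) * (u * a))" by (simp add: norm_star_mult_self)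
  also have "star (u * a) * (u * a) = star a * (star u * u * a)" by (simp add: star_mult mult.assoc)
  finally have "(norm (u * a))\<^sup>2 = (norm a)\<^sup>2" by (simp add: assms norm_star_mult_self)
  then show ?thesis by (simp add: power2_eq_iff_nonneg)
qed

text \<open>The element \<open>u\<close> is \<open>(1 - \<i> k) / (1 + \<i> k)\<close>. Since \<open>k\<close> has norm less than one, the inverse \<open>r\<close> of
  \<open>1 + \<i> k\<close> is the fixed point of a contraction. The last equation expresses \<open>k\<close> as a multiple
  of \<open>1 - u\<close>, which is what averages of powers of \<open>u\<close> nearly annihilate.\<close>

lemma Cayley_transform:
  fixes e k :: "'b::cstar_algebra"
  assumes e: "\<And>y. e * y = y" "\<And>y. y * e = y" and k: "star k = k" "norm k < 1"
  obtains u where "star u * u = e" "(e - u) * (e + \<i> *\<^sub>C k) = (2 * \<i>) *\<^sub>C k"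
proof -
  have "\<exists>!r. e - \<i> *\<^sub>C (k * r) = r"
  proof (rule banach_fix_type[OF norm_ge_zero k(2)], intro allI)
    fix y z
    have "norm ((e - \<i> *\<^sub>C (k * y)) - (e - \<i> *\<^sub>C (k * z))) = norm (\<i> *\<^sub>C (k * (z - y)))"
      by (simp add: right_diff_distrib scaleC_diff_right)
    also have "\<dots> \<le> norm k * norm (y - z)"
      using norm_mult_ineq[of k "z - y"] by (simp add: norm_scaleC norm_minus_commute)
    finally show "dist (e - \<i> *\<^sub>C (k * y)) (e - \<i> *\<^sub>C (k * z)) \<le> norm k * dist y z"
      by (simp add: dist_norm)
  qed
  then obtain r where r0: "e - \<i> *\<^sub>C (k * r) = r" by blast
  then have r: "r + \<i> *\<^sub>C (k * r) = e" by (simp add: diff_eq_eq)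
  have star_e: "star e = e"
  proof -
    have "star e = star (star e) * star e" by (simp only: star_star e)
    also have "\<dots> = star (e * star e)" by (rule star_mult[symmetric])
    also have "\<dots> = e" by (simp only: star_star e)
    finally show ?thesis .
  qed
  have inj: "y = 0" if "y + \<i> *\<^sub>C (k * y) = 0" for y
  proof (rule ccontr)
    assume "y \<noteq> 0"
    then have "norm k * norm y < 1 * norm y" using k by (intro mult_strict_right_mono) auto
    moreover have "norm y = norm (k * y)"
    proof -
      have "y = - (\<i> *\<^sub>C (k * y))" using that by (simp add: eq_neg_iff_add_eq_0)
      then have "norm y = norm (- (\<i> *\<^sub>C (k * y)))" by (rule arg_cong)
      then show ?thesis by (simp add: norm_scaleC)
    qed
    ultimately show False using norm_mult_ineq[of k y] by simp
  qed
  have r': "r + \<i> *\<^sub>C (r * k) = e"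
  proof -
    let ?y = "r + \<i> *\<^sub>C (r * k) - e"
    have "?y + \<i> *\<^sub>C (k * ?y) = (r + \<i> *\<^sub>C (k * r)) + \<i> *\<^sub>C ((r + \<i> *\<^sub>C (k * r)) * k) - e - \<i> *\<^sub>C k"
      by (simp add: algebra_simps e scaleC_add_right scaleC_diff_right scaleC_mult_left scaleC_mult_right)
    also have "\<dots> = 0" by (simp add: r e)
    finally have "?y = 0" by (rule inj)
    then show ?thesis by simp
  qed
  define u where "u = r - \<i> *\<^sub>C (k * r)"
  have rs: "star r - \<i> *\<^sub>C (star r * k) = e"
    using arg_cong[OF r, of star] by (simp add: star_add star_scaleC star_mult k star_e scaleC_minus_left)
  have comm: "(e + \<i> *\<^sub>C k) * (e - \<i> *\<^sub>C k) = (e - \<i> *\<^sub>C k) * (e + \<i> *\<^sub>C k)"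
    by (simp add: algebra_simps e scaleC_mult_left scaleC_mult_right scaleC_add_right scaleC_diff_right)
  have u: "u = (e - \<i> *\<^sub>C k) * r" by (simp add: u_def algebra_simps e scaleC_mult_left)
  have "star u = star r * (e + \<i> *\<^sub>C k)"
    unfolding u by (simp add: star_mult star_diff star_scaleC star_e k scaleC_minus_left)
  then have "star u * u = star r * ((e + \<i> *\<^sub>C k) * (e - \<i> *\<^sub>C k)) * r" by (simp add: u mult.assoc)
  also have "\<dots> = (star r - \<i> *\<^sub>C (star r * k)) * (r + \<i> *\<^sub>C (k * r))"
    unfolding comm by (simp add: algebra_simps e scaleC_mult_left scaleC_mult_right)
  finally have uu: "star u * u = e" by (simp add: rs r e)
  have eu: "e - u = (2 * \<i>) *\<^sub>C (k * r)"
    by (subst r[symmetric]) (simp add: u_def scaleC_add_left[of \<i> \<i>, simplified])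
  have "(e - u) * (e + \<i> *\<^sub>C k) = (2 * \<i>) *\<^sub>C (k * (r + \<i> *\<^sub>C (r * k)))"
    unfolding eu
    by (simp add: algebra_simps e scaleC_mult_left scaleC_mult_right scaleC_add_right scaleC_scaleC)
  then have "(e - u) * (e + \<i> *\<^sub>C k) = (2 * \<i>) *\<^sub>C k" by (simp add: r' e)
  with uu that show thesis by blast
qed

text \<open>Let \<open>u\<close> be the Cayley transform of a small multiple \<open>k\<close> of \<open>h\<close>, formed in the unitization, and
  \<open>m\<close> the mean of \<open>1, u, \<dots>, u\<^sup>n\<close>. The sum telescopes against \<open>1 - u\<close>, so \<open>m * (1 - u)\<close> and
  hence \<open>m * k\<close> is of size \<open>1 / n\<close>, while \<open>m\<close> has norm at most one because \<open>u\<close> is an isometry. All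
  powers of \<open>u\<close> have scalar part one, so \<open>1 - m\<close> lies in the algebra and can serve as \<open>b\<close>; its
  norm is at most two.\<close>

lemma local_approximate_unit_selfadjoint:
  fixes h :: "'a::cstar_algebra"
  assumes h: "star h = h" and "\<epsilon> > 0"
  obtains b where "norm b \<le> 2" "norm (h - b * h) \<le> \<epsilon>"
proof -
  define e where "e = Unitization (0::'a) 1"
  have e: "e * y = y" "y * e = y" for y by (simp_all add: e_def times_unitization_def)
  have norm_e: "norm e = 1"
  proof -
    have "star e = e" by (simp add: e_def star_unitization_def)
    then have "norm e = (norm e)\<^sup>2" using norm_star_mult_self[of e] e by simp
    moreover have "e \<noteq> 0" by (simp add: e_def zero_unitization_def)
    ultimately show ?thesis by (simp add: power2_eq_square)
  qed
  \<comment> \<open>The factor \<open>t\<close> brings \<open>h\<close> into the open unit ball, as \<open>Cayley_transform\<close> demands.\<close>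
  define t where "t = inverse (norm h + 1)"
  have t: "t > 0" "norm (t *\<^sub>R h) < 1"
    by (simp_all add: t_def add_nonneg_pos divide_simps)
  define k where "k = Unitization (t *\<^sub>R h) 0"
  have k: "star k = k" "norm k < 1"
    using t by (simp_all add: k_def star_unitization_def star_scaleR h)
  obtain u where u: "star u * u = e"
    and uk: "(e - u) * (e + \<i> *\<^sub>C k) = (2 * \<i>) *\<^sub>C k"
    using Cayley_transform[OF e k] .
  have scalar_u: "scalar_part u = 1"
  proof -
    have "scalar_part ((e - u) * (e + \<i> *\<^sub>C k)) = 0"
      unfolding uk by (simp add: k_def scaleC_unitization_def)
    then show ?thesis
      by (simp add: times_unitization_def minus_unitization_def plus_unitization_def
          scaleC_unitization_def e_def k_def)
  qed
  define w where "w n = ((\<lambda>y. u * y) ^^ n) e" for n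
  have w_Suc: "w (Suc n) = u * w n" "w 0 = e" for n by (simp_all add: w_def)
  have w_norm: "norm (w n) = 1" for n
    by (induction n) (simp_all add: w_Suc norm_e isometry_norm_mult u e)
  have w_comm: "w n * u = w (Suc n)" for n
    by (induction n) (simp_all add: w_Suc e mult.assoc)
  have w_scalar: "scalar_part (w n) = 1" for n
    by (induction n) (simp_all add: w_Suc e_def times_unitization_def scalar_u)
  define m where "m n = (1 / real (Suc n)) *\<^sub>R (\<Sum>i\<le>n. w i)" for n
  have sum_scalar: "scalar_part (sum w A) = (\<Sum>i\<in>A. scalar_part (w i))" for A
    by (induction A rule: infinite_finite_induct) (simp_all add: zero_unitization_def plus_unitization_def)
  have m_scalar: "scalar_part (m n) = 1" for n
    by (simp add: m_def scaleR_unitization_def sum_scalar w_scalar scaleR_conv_of_real divide_simps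
        del: of_nat_Suc)
  have m_norm: "norm (m n) \<le> 1" for n
    using norm_sum[of w "{..n}"] by (simp add: m_def w_norm divide_simps)
  have tele: "(\<Sum>i\<le>n. w i) * (e - u) = e - w (Suc n)" for n
  proof (induction n)
    case (Suc n)
    have "w (Suc n) * (e - u) = w (Suc n) - w (Suc (Suc n))"
      by (simp only: right_diff_distrib e w_comm)
    with Suc show ?case by (simp add: distrib_right)
  qed (simp add: w_Suc e)
  have m_k: "norm (m n * k) \<le> 2 / real (Suc n)" for n
  proof -
    have "2 * norm (m n * k) = norm (m n * ((e - u) * (e + \<i> *\<^sub>C k)))"
      unfolding uk by (simp add: scaleC_mult_right norm_scaleC)
    also have "m n * ((e - u) * (e + \<i> *\<^sub>C k)) = (1 / real (Suc n)) *\<^sub>R ((e - w (Suc n)) * (e + \<i> *\<^sub>C k))"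
      by (simp add: m_def tele[symmetric] mult.assoc)
    also have "norm \<dots> \<le> (1 / real (Suc n)) * (norm (e - w (Suc n)) * norm (e + \<i> *\<^sub>C k))"
      using norm_mult_ineq[of "e - w (Suc n)" "e + \<i> *\<^sub>C k"] by (simp add: divide_right_mono)
    also have "\<dots> \<le> (1 / real (Suc n)) * (2 * 2)"
    proof (intro mult_left_mono mult_mono)
      show "norm (e - w (Suc n)) \<le> 2"
        using norm_triangle_ineq4[of e "w (Suc n)"] by (simp add: norm_e w_norm)
      show "norm (e + \<i> *\<^sub>C k) \<le> 2"
        using norm_triangle_ineq[of e "\<i> *\<^sub>C k"] k by (simp add: norm_e norm_scaleC)
    qed simp_all
    finally show ?thesis by simp
  qed
  obtain n where n0: "2 / (t * \<epsilon>) < real n" using reals_Archimedean2 by blast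
  have n: "2 / real (Suc n) \<le> t * \<epsilon>"
  proof -
    have "t * \<epsilon> > 0" using t \<open>\<epsilon> > 0\<close> by simp
    with n0 have "2 \<le> real n * (t * \<epsilon>) + t * \<epsilon>" by (simp add: pos_divide_less_eq)
    then show ?thesis by (simp add: divide_le_eq algebra_simps)
  qed
  define b where "b = - alg_part (m n)"
  have b: "Unitization b 0 = e - m n"
    by (simp add: b_def e_def minus_unitization_def m_scalar)
  show thesis
  proof
    have "norm b = norm (e - m n)" by (metis b norm_Unitization_zero)
    also have "\<dots> \<le> 2" using norm_triangle_ineq4[of e "m n"] m_norm[of n] by (simp add: norm_e)
    finally show "norm b \<le> 2" .
    have "t * norm (h - b * h) = norm (Unitization (t *\<^sub>R (h - b * h)) 0)" using t by simp
    also have "Unitization (t *\<^sub>R (h - b * h)) 0 = k - Unitization b 0 * k"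
      by (simp add: k_def minus_unitization_def times_unitization_def scaleR_diff_right)
    also have "k - Unitization b 0 * k = m n * k" by (simp add: b left_diff_distrib e)
    finally have "t * norm (h - b * h) \<le> t * \<epsilon>" using m_k[of n] n by simp
    with t show "norm (h - b * h) \<le> \<epsilon>" by simp
  qed
qed

text \<open>Since \<open>(a - b a) (a - b a)\<^sup>* = (h - b h) - (h - b h) b\<^sup>*\<close> for \<open>h = a a\<^sup>*\<close>, an approximate unit for \<open>h\<close>
  is one for \<open>a\<close>. The third of \<open>\<epsilon>\<^sup>2\<close> compensates the factor \<open>1 + \<parallel>b\<parallel> \<le> 3\<close>.\<close>

lemma local_approximate_unit:
  fixes a :: "'a::cstar_algebra"
  assumes "\<epsilon> > 0"
  obtains b where "norm b \<le> 2" "norm (a - b * a) \<le> \<epsilon>"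
proof -
  have "star (a * star a) = a * star a" by (simp add: star_mult star_star)
  moreover have "\<epsilon>\<^sup>2 / 3 > 0" using assms by simp
  ultimately obtain b where b: "norm b \<le> 2" "norm (a * star a - b * (a * star a)) \<le> \<epsilon>\<^sup>2 / 3"
    by (rule local_approximate_unit_selfadjoint)
  let ?d = "a * star a - b * (a * star a)"
  have "(norm (a - b * a))\<^sup>2 = norm (star (star (a - b * a)) * star (a - b * a))"
    by (simp only: norm_star_mult_self norm_star)
  also have "star (star (a - b * a)) * star (a - b * a) = ?d - ?d * star b"
    by (simp add: star_star star_diff star_mult algebra_simps)
  also have "norm \<dots> \<le> norm ?d + norm ?d * norm b"
    using norm_triangle_ineq4[of ?d "?d * star b"] norm_mult_ineq[of ?d "star b"] by simp
  also have "\<dots> \<le> \<epsilon>\<^sup>2 / 3 + \<epsilon>\<^sup>2 / 3 * 2"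
    using b by (intro add_mono mult_mono) simp_all
  finally have "(norm (a - b * a))\<^sup>2 \<le> \<epsilon>\<^sup>2" by simp
  then have "norm (a - b * a) \<le> \<epsilon>" by (rule power2_le_imp_le) (use assms in simp)
  with b that show thesis by blast
qed

section \<open>Extension of positive functionals to the unitization\<close>

text \<open>With a unit this would be the Cauchy-Schwarz inequality for \<open>1\<close> and \<open>a\<close>. Here the unit is replaced by a
  local approximate unit \<open>b\<close> of \<open>a\<close>, and the factor four is the bound of \<open>\<parallel>b\<parallel>\<^sup>2\<close>.\<close>

lemma positive_functional_bound:
  fixes \<psi> :: "'a::cstar_algebra \<Rightarrow> complex"
  assumes "positive_functional \<psi>"
  shows "(cmod (\<psi> a))\<^sup>2 \<le> 4 * onorm \<psi> * Re (\<psi> (star a * a))"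
proof -
  have \<psi>: "\<psi> \<in> cdual" using assms(1) by (simp add: positive_functional_def)
  let ?N = "onorm \<psi>" and ?q = "Re (\<psi> (star a * a))"
  have N: "0 \<le> ?N" using onorm_pos_le[OF cdualD(1)[OF \<psi>]] .
  have q: "0 \<le> ?q"
    using semi_inner_product.sq_nonneg[OF semi_inner_product_functional[OF assms]] .
  have approx: "cmod (\<psi> a) \<le> sqrt (4 * ?N * ?q) + ?N * \<epsilon>" if "\<epsilon> > 0" for \<epsilon>
  proof -
    obtain b where b: "norm b \<le> 2" "norm (a - b * a) \<le> \<epsilon>"
      using local_approximate_unit[OF \<open>\<epsilon> > 0\<close>] .
    have "(norm b)\<^sup>2 \<le> 2\<^sup>2" using b by (intro power_mono) simp_all
    then have "Re (\<psi> (b * star b)) \<le> ?N * 4"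
      using order_trans[OF functional_star_mult_le[OF \<psi>, of "star b"] mult_left_mono[OF _ N]]
      by (simp add: star_star)
    then have "(cmod (\<psi> (b * a)))\<^sup>2 \<le> (?N * 4) * ?q"
      using positive_functional_Cauchy_Schwarz[OF assms, of "star b" a] mult_right_mono[OF _ q]
      by (simp add: star_star order_trans)
    then have "cmod (\<psi> (b * a)) \<le> sqrt (4 * ?N * ?q)" by (simp add: real_le_rsqrt mult_ac)
    moreover have "cmod (\<psi> (a - b * a)) \<le> ?N * \<epsilon>"
      by (rule order_trans[OF cdualD(8)[OF \<psi>] mult_left_mono[OF b(2) N]])
    moreover have "\<psi> a = \<psi> (b * a) + \<psi> (a - b * a)" by (simp add: cdualD[OF \<psi>])
    ultimately show ?thesis using norm_triangle_ineq[of "\<psi> (b * a)" "\<psi> (a - b * a)"] by simp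
  qed
  have "cmod (\<psi> a) \<le> sqrt (4 * ?N * ?q) + ?N * 0"
    by (rule le_at_zeroI[of "\<lambda>\<epsilon>. sqrt (4 * ?N * ?q) + ?N * \<epsilon>", OF _ approx]) simp_all
  then have "(cmod (\<psi> a))\<^sup>2 \<le> (sqrt (4 * ?N * ?q))\<^sup>2" by (intro power_mono) simp_all
  with N q show ?thesis by simp
qed

text \<open>Hermitian symmetry of the semi-inner product gives this for products \<open>b * a\<close>, which are dense by
  the existence of local approximate units.\<close>

lemma positive_functional_star:
  fixes \<psi> :: "'a::cstar_algebra \<Rightarrow> complex"
  assumes "positive_functional \<psi>"
  shows "\<psi> (star a) = cnj (\<psi> a)"
proof -
  interpret semi_inner_product "\<lambda>a b. \<psi> (star a * b)"
    by (rule semi_inner_product_functional[OF assms])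
  have \<psi>: "\<psi> \<in> cdual" using assms(1) by (simp add: positive_functional_def)
  let ?N = "onorm \<psi>"
  have N: "0 \<le> ?N" using onorm_pos_le[OF cdualD(1)[OF \<psi>]] .
  have approx: "cmod (\<psi> (star a) - cnj (\<psi> a)) \<le> 2 * ?N * \<epsilon>" if "\<epsilon> > 0" for \<epsilon>
  proof -
    obtain b where b: "norm (a - b * a) \<le> \<epsilon>"
      using local_approximate_unit[OF \<open>\<epsilon> > 0\<close>] .
    have "\<psi> (star (b * a)) = cnj (\<psi> (b * a))"
      using hermitian[of a "star b"] by (simp add: star_mult star_star)
    then have "\<psi> (star a) - cnj (\<psi> a) = \<psi> (star (a - b * a)) - cnj (\<psi> (a - b * a))"
      by (simp add: star_diff cdualD[OF \<psi>])
    then have "cmod (\<psi> (star a) - cnj (\<psi> a))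
        \<le> cmod (\<psi> (star (a - b * a))) + cmod (\<psi> (a - b * a))"
      using norm_triangle_ineq4[of "\<psi> (star (a - b * a))" "cnj (\<psi> (a - b * a))"] by simp
    also have "\<dots> \<le> ?N * norm (a - b * a) + ?N * norm (a - b * a)"
      using cdualD(8)[OF \<psi>, of "star (a - b * a)"] cdualD(8)[OF \<psi>, of "a - b * a"]
      by (simp only: norm_star add_mono)
    finally show ?thesis using mult_left_mono[OF b N] by simp
  qed
  have "cmod (\<psi> (star a) - cnj (\<psi> a)) \<le> 2 * ?N * 0"
    by (rule le_at_zeroI[of "\<lambda>\<epsilon>. 2 * ?N * \<epsilon>", OF _ approx]) simp_all
  then show ?thesis by simp
qed

text \<open>At \<open>star u * u\<close> with \<open>u = a + c\<close> the extension takes the value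
  \<open>\<psi> (star a * a) + 2 * Re (cnj c * \<psi> a) + M * \<bar>c\<bar>\<^sup>2\<close>, and the bound on \<open>\<psi>\<close> says that this quadratic form is nonnegative.\<close>

lemma positive_functional_unitization:
  fixes \<psi> :: "'a::cstar_algebra \<Rightarrow> complex"
  assumes "positive_functional \<psi>" and M: "\<And>a. (cmod (\<psi> a))\<^sup>2 \<le> M * Re (\<psi> (star a * a))" "0 \<le> M"
  shows "positive_functional (\<lambda>u. \<psi> (alg_part u) + of_real M * scalar_part u)"
  unfolding positive_functional_def
proof
  have \<psi>: "\<psi> \<in> cdual" using assms(1) by (simp add: positive_functional_def)
  have "bounded_linear (alg_part :: 'a unitization \<Rightarrow> 'a)"
    using norm_alg_part_le
    by (intro bounded_linear_intro[of _ 2]) (auto simp: plus_unitization_def scaleR_unitization_def mult.commute)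
  moreover have "bounded_linear (scalar_part :: 'a unitization \<Rightarrow> complex)"
    using scalar_part_le_norm
    by (intro bounded_linear_intro[of _ 1]) (auto simp: plus_unitization_def scaleR_unitization_def)
  ultimately have "bounded_linear (\<lambda>u. \<psi> (alg_part u) + of_real M * scalar_part u)"
    by (intro bounded_linear_add bounded_linear_compose[OF cdualD(1)[OF \<psi>]]
        bounded_linear_compose[OF bounded_linear_mult_right])
  then show "(\<lambda>u. \<psi> (alg_part u) + of_real M * scalar_part u) \<in> cdual"
    by (simp add: cdual_def scaleC_unitization_def cdualD[OF \<psi>] algebra_simps)
  interpret semi_inner_product "\<lambda>a b. \<psi> (star a * b)"
    by (rule semi_inner_product_functional[OF assms(1)])
  show "\<forall>u. \<psi> (alg_part (star u * u)) + of_real M * scalar_part (star u * u) \<in> \<real>\<^sub>\<ge>\<^sub>0"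
  proof
    fix u :: "'a unitization"
    obtain a c where u: "u = Unitization a c" by (cases u)
    have s: "0 \<le> sq a" "\<psi> (star a * a) = of_real (sq a)"
      using sq_nonneg[of a] self_real[of a] by (simp_all add: complex_eq_iff)
    have "cmod (\<psi> a) \<le> sqrt M * sqrt (sq a)"
      using M(1)[of a] by (simp add: real_le_rsqrt flip: real_sqrt_mult)
    then have "cmod c * cmod (\<psi> a) \<le> cmod c * (sqrt M * sqrt (sq a))"
      by (rule mult_left_mono) simp
    then have "- (cmod c * (sqrt M * sqrt (sq a))) \<le> Re (cnj c * \<psi> a)"
      using abs_Re_le_cmod[of "cnj c * \<psi> a", unfolded norm_mult complex_mod_cnj] by linarith
    moreover have "0 \<le> sq a - 2 * (cmod c * (sqrt M * sqrt (sq a))) + M * (cmod c)\<^sup>2"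
      using zero_le_power2[of "sqrt (sq a) - cmod c * sqrt M"] s M(2)
      by (simp add: power2_diff power_mult_distrib algebra_simps)
    ultimately have "0 \<le> sq a + 2 * Re (cnj c * \<psi> a) + M * (cmod c)\<^sup>2" by linarith
    moreover have "\<psi> (alg_part (star u * u)) + of_real M * scalar_part (star u * u)
        = of_real (sq a + 2 * Re (cnj c * \<psi> a) + M * (cmod c)\<^sup>2)"
    proof -
      have "\<psi> (alg_part (star u * u)) = of_real (sq a) + (cnj c * \<psi> a + cnj (cnj c * \<psi> a))"
        by (simp add: u star_unitization_def times_unitization_def cdualD[OF \<psi>] s(2)[symmetric]
            positive_functional_star[OF assms(1)])
      moreover have "scalar_part (star u * u) = of_real ((cmod c)\<^sup>2)"
        using complex_norm_square[of c]
        by (simp add: u star_unitization_def times_unitization_def mult.commute[of "cnj c"])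
      ultimately show ?thesis
        by (simp only: complex_add_cnj) (simp add: algebra_simps)
    qed
    ultimately show "\<psi> (alg_part (star u * u)) + of_real M * scalar_part (star u * u) \<in> \<real>\<^sub>\<ge>\<^sub>0"
      by (simp only: complex_nonneg_Reals_iff Re_complex_of_real Im_complex_of_real)
  qed
qed

section \<open>Frames and positive functionals\<close>

text \<open>This is the argument with \<open>e \<Omega>\<close> close to \<open>\<Omega>\<close>. The element \<open>e\<close> represents \<open>\<psi>\<close> itself up to \<open>\<epsilon>\<close>, which
  is to say \<open>\<parallel>e \<Omega> - \<Omega>\<parallel> \<le> \<epsilon>\<close>. As \<open>\<Omega>\<close> is not at hand, \<open>\<langle>e \<Omega>, S e \<Omega>\<rangle>\<close> is estimated by comparing
  \<open>\<psi> (star e * (S * e))\<close> with \<open>\<psi> (S * e) = 0\<close>; the error involves \<open>\<parallel>S e \<Omega>\<parallel>\<^sup>2\<close>, which the upper frame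
  bound controls by \<open>\<langle>e \<Omega>, S e \<Omega>\<rangle>\<close> again.\<close>

lemma functional_zero_of_frame_bounds:
  fixes \<psi> :: "'a::cstar_algebra \<Rightarrow> complex"
  assumes \<psi>: "positive_functional \<psi>"
    and c: "c1 > 0" "c2 > 0"
    and sum: "\<And>y. ((\<lambda>j. Re (\<psi> (star y * x j * (star (x j) * y)))) has_sum L y) J"
    and lower: "\<And>y. c1 * Re (\<psi> (star y * y)) \<le> L y"
    and upper: "\<And>y. L y \<le> c2 * Re (\<psi> (star y * y))"
    and zero: "\<And>j. j \<in> J \<Longrightarrow> \<psi> (x j * star (x j)) = 0"
  shows "\<psi> a = 0"
proof -
  interpret semi_inner_product "\<lambda>a b. \<psi> (star a * b)"
    by (rule semi_inner_product_functional[OF \<psi>])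
  have \<psi>': "\<psi> \<in> cdual" using \<psi> by (simp add: positive_functional_def)
  have nonneg_j: "0 \<le> Re (\<psi> (star y * x j * (star (x j) * y)))" for j y
    using sq_nonneg[of "star (x j) * y"] by (simp add: star_mult star_star mult.assoc)
  have null: "\<psi> (x j * z) = 0" if "j \<in> J" for j z
    using Cauchy_Schwarz[of "star (x j)" z] zero[OF that] by (simp add: star_star)
  have small: "L e \<le> \<epsilon>\<^sup>2 * c2"
    if e: "\<And>y. (cmod (\<psi> y - \<psi> (star e * y)))\<^sup>2 \<le> \<epsilon>\<^sup>2 * sq y" for e \<epsilon>
  proof (rule has_sum_le_finite_sums[OF sum])
    fix F assume F: "finite F" "F \<subseteq> J"
    define S where "S = (\<Sum>j\<in>F. x j * star (x j))"
    have S_form: "\<psi> (star y * S * z) = (\<Sum>j\<in>F. \<psi> (star y * x j * (star (x j) * z)))" for y z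
      by (simp add: S_def sum_distrib_left sum_distrib_right cdualD[OF \<psi>'] mult.assoc)
    have star_S: "star S = S"
    proof -
      have "star S = (\<Sum>j\<in>F. star (x j * star (x j)))"
        unfolding S_def by (induction F rule: infinite_finite_induct) (simp_all add: star_add)
      then show ?thesis by (simp add: S_def star_mult star_star)
    qed
    interpret S: semi_inner_product "\<lambda>a b. \<psi> (star a * S * b)"
    proof
      fix y
      have "\<psi> (star y * S * y) = (\<Sum>j\<in>F. \<psi> (star (star (x j) * y) * (star (x j) * y)))"
        unfolding S_form by (simp add: star_mult star_star mult.assoc)
      also have "\<dots> \<in> \<real>\<^sub>\<ge>\<^sub>0" by (simp add: complex_nonneg_Reals_iff sum_nonneg sq_nonneg self_real)
      finally show "\<psi> (star y * S * y) \<in> \<real>\<^sub>\<ge>\<^sub>0" .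
    qed (simp_all add: cdualD[OF \<psi>'] star_add star_scaleC distrib_left distrib_right
      scaleC_mult_left scaleC_mult_right)
    have S_le: "S.sq y \<le> c2 * sq y" for y
    proof -
      have "S.sq y \<le> L y"
        using finite_sum_le_has_sum[OF sum F(1,2) nonneg_j] by (simp add: S_form)
      with upper[of y] show ?thesis by simp
    qed
    let ?p = "S.sq e" and ?q = "sq (S * e)"
    \<comment> \<open>The operator inequality \<open>S\<^sup>2 \<le> c2 S\<close> at the vector \<open>e \<Omega>\<close>, which follows from \<open>0 \<le> S \<le> c2\<close> by the Cauchy-Schwarz
      inequality for the form given by \<open>S\<close>.\<close>
    have q: "?q \<le> c2 * ?p"
    proof -
      have "?q = Re (\<psi> (star e * S * (S * e)))" by (simp add: star_mult star_S mult.assoc)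
      then have "?q\<^sup>2 \<le> (cmod (\<psi> (star e * S * (S * e))))\<^sup>2"
        using abs_Re_le_cmod by (simp add: abs_le_square_iff[symmetric])
      also have "\<dots> \<le> ?p * S.sq (S * e)" by (rule S.Cauchy_Schwarz)
      also have "\<dots> \<le> ?p * (c2 * ?q)" by (rule mult_left_mono[OF S_le S.sq_nonneg])
      finally have "?q * ?q \<le> (c2 * ?p) * ?q" by (simp add: power2_eq_square mult_ac)
      then show ?thesis
        using sq_nonneg[of "S * e"] S.sq_nonneg[of e] c(2)
        by (cases "?q = 0") (auto simp: mult_le_cancel_right)
    qed
    have "\<psi> (S * e) = 0"
      using F by (simp add: S_def sum_distrib_right cdualD[OF \<psi>'] mult.assoc null subset_iff)
    then have "?p\<^sup>2 \<le> (cmod (\<psi> (S * e) - \<psi> (star e * (S * e))))\<^sup>2"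
      using abs_Re_le_cmod[of "\<psi> (star e * S * e)"]
      by (simp add: abs_le_square_iff[symmetric] mult.assoc)
    also have "\<dots> \<le> \<epsilon>\<^sup>2 * ?q" by (rule e)
    also have "\<dots> \<le> \<epsilon>\<^sup>2 * (c2 * ?p)" by (rule mult_left_mono[OF q]) simp
    finally have "?p * ?p \<le> (\<epsilon>\<^sup>2 * c2) * ?p" by (simp add: power2_eq_square mult_ac)
    then have "?p \<le> \<epsilon>\<^sup>2 * c2"
      using S.sq_nonneg[of e] c(2) by (cases "?p = 0") (auto simp: mult_le_cancel_right)
    then show "(\<Sum>j\<in>F. Re (\<psi> (star e * x j * (star (x j) * e)))) \<le> \<epsilon>\<^sup>2 * c2"
      by (simp add: S_form)
  qed
  have approx: "cmod (\<psi> a) \<le> \<epsilon> * (1 + sqrt (c2 / c1)) * sqrt (sq a)" if "\<epsilon> > 0" for \<epsilon>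
  proof -
    obtain e where e: "\<And>y. (cmod (\<psi> y - \<psi> (star e * y)))\<^sup>2 \<le> \<epsilon>\<^sup>2 * sq y"
      using approximate_Riesz[of \<psi>, OF cdualD(2)[OF \<psi>'] cdualD(4)[OF \<psi>']
          positive_functional_bound[OF \<psi>] \<open>\<epsilon> > 0\<close>] by blast
    \<comment> \<open>Here the lower frame bound enters: \<open>e \<Omega>\<close>, and with it \<open>\<Omega>\<close>, is of size \<open>\<epsilon>\<close>.\<close>
    have "sq e \<le> \<epsilon>\<^sup>2 * (c2 / c1)"
      using order_trans[OF lower small[OF e]] c by (simp add: field_simps)
    then have "sq e * sq a \<le> (\<epsilon> * sqrt (c2 / c1) * sqrt (sq a))\<^sup>2"
      using c sq_nonneg[of a] mult_right_mono[of "sq e" "\<epsilon>\<^sup>2 * (c2 / c1)" "sq a"]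
      by (simp add: power_mult_distrib)
    then have "cmod (\<psi> (star e * a)) \<le> \<epsilon> * sqrt (c2 / c1) * sqrt (sq a)"
      by (rule power2_le_imp_le[OF order_trans[OF Cauchy_Schwarz]])
        (use c sq_nonneg[of a] \<open>\<epsilon> > 0\<close> in simp)
    moreover have "cmod (\<psi> a - \<psi> (star e * a)) \<le> \<epsilon> * sqrt (sq a)"
      by (rule power2_le_imp_le)
        (use e[of a] sq_nonneg[of a] \<open>\<epsilon> > 0\<close> in \<open>simp_all add: power_mult_distrib\<close>)
    ultimately show ?thesis
      using norm_triangle_sub[of "\<psi> a" "\<psi> (star e * a)"] by (simp add: algebra_simps)
  qed
  have "cmod (\<psi> a) \<le> 0 * (1 + sqrt (c2 / c1)) * sqrt (sq a)"
    by (rule le_at_zeroI[of "\<lambda>\<epsilon>. \<epsilon> * (1 + sqrt (c2 / c1)) * sqrt (sq a)", OF _ approx]) simp_all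
  then show ?thesis by simp
qed

theorem theorem4p2:
  fixes J :: "'j set" and x :: "'j \<Rightarrow> 'a::cstar_algebra" and \<psi> :: "'a \<Rightarrow> complex"
  assumes "frame_in_algebra J x"
    and "state \<psi>"
  shows "\<exists>j\<in>J. \<psi> (x j * star (x j)) \<noteq> 0"
proof (rule ccontr)
  assume "\<not> ?thesis"
  then have zero: "\<psi> (x j * star (x j)) = 0" if "j \<in> J" for j using that by blast
  have \<psi>: "positive_functional \<psi>" and norm: "onorm \<psi> = 1"
    using assms(2) unfolding state_def positive_functional_def positive_def by blast+
  have "\<psi> a = 0" for a
  proof (cases "unital TYPE('a)")
    case True
    interpret hilbert_cstar_module ip_self "(*) :: 'a \<Rightarrow> 'a \<Rightarrow> 'a"
      by (rule hilbert_cstar_module_self)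
    have frame: "frame J x" using assms(1) True by (simp add: frame_in_algebra_def)
    show ?thesis
    proof (rule frame_positive_functional[OF frame \<psi>])
      fix c1 c2 L
      assume "c1 > 0" "c2 > 0"
        and "\<And>y. ((\<lambda>j. Re (\<psi> (ip_self y (x j) * ip_self (x j) y))) has_sum L y) J"
        and "\<And>y. c1 * Re (\<psi> (ip_self y y)) \<le> L y"
        and "\<And>y. L y \<le> c2 * Re (\<psi> (ip_self y y))"
      then show ?thesis
        unfolding ip_self_def
        by (rule functional_zero_of_frame_bounds[where x = x and J = J, OF \<psi> _ _ _ _ _ zero])
    qed
  next
    case False
    interpret hilbert_cstar_module ip_unitization "act_unitization :: 'a \<Rightarrow> _"
      by (rule hilbert_cstar_module_unitization)
    have frame: "frame J x" using assms(1) False by (simp add: frame_in_algebra_def)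
    \<comment> \<open>Any positive extension of \<open>\<psi>\<close> will do, since all inner products lie in the algebra; the value four
      at the unit is the constant of \<open>positive_functional_bound\<close> for norm one.\<close>
    define \<omega> where "\<omega> = (\<lambda>u. \<psi> (alg_part u) + of_real 4 * scalar_part u)"
    have "(cmod (\<psi> b))\<^sup>2 \<le> 4 * Re (\<psi> (star b * b))" for b
      using positive_functional_bound[OF \<psi>, of b] by (simp add: norm)
    then have \<omega>: "positive_functional \<omega>"
      unfolding \<omega>_def by (rule positive_functional_unitization[OF \<psi>]) simp
    have ip: "\<omega> (ip_unitization y z) = \<psi> (star y * z)"
      "\<omega> (ip_unitization y z * ip_unitization v w) = \<psi> (star y * z * (star v * w))" for y z v w
      by (simp_all add: \<omega>_def ip_unitization_def times_unitization_def)
    show ?thesis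
    proof (rule frame_positive_functional[OF frame \<omega>])
      fix c1 c2 L
      assume "c1 > 0" "c2 > 0"
        and "\<And>y. ((\<lambda>j. Re (\<omega> (ip_unitization y (x j) * ip_unitization (x j) y))) has_sum L y) J"
        and "\<And>y. c1 * Re (\<omega> (ip_unitization y y)) \<le> L y"
        and "\<And>y. L y \<le> c2 * Re (\<omega> (ip_unitization y y))"
      then show ?thesis
        unfolding ip
        by (rule functional_zero_of_frame_bounds[where x = x and J = J, OF \<psi> _ _ _ _ _ zero])
    qed
  qed
  then have "\<psi> = (\<lambda>_. 0)" by (rule ext)
  with norm show False by (simp add: onorm_zero)
qed

end
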